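(* Let $\rho$ be a probability density over a domain $\mathcal{X}\subset\mathbb{R}^d$ satisfying the Boman chain condition for some covering $\mathcal{F}$ and some parameters $A,B,C>1$. Assume moreover that there exists $D>0$ such that $$\rho(5B\sqrt d\,Q)\le D\,\rho(Q)\qquad\forall Q\in\mathcal{F},$$ and that there exists $E>0$ such that $$\sup_{Q\in\mathcal{F}}\frac{M_{\rho_Q}}{m_{\rho_Q}}\le E<+\infty.$$ Then for any compact $\mathcal{Y}\subset\mathbb{R}^d$ there exists a constant $K>0$ depending only on $\rho$ and $\mathcal{Y}$ such that for all $\psi_0,\psi_1\in C_b(\mathcal{Y})$, $$\operatorname{Var}_\rho(\psi_1^*-\psi_0^* )\le K\left(\mathcal{K}_\rho(\psi_1)-\mathcal{K}_\rho(\psi_0)+\langle\psi_1-\psi_0\,|\,(\nabla\psi_0^* )_\#\rho\rangle\right).$$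
   Context: Boman chain condition: a probability measure $\rho$ on an open set $\mathcal{X}\subset\mathbb{R}^d$ satisfies it with parameters $A,B,C>1$ if there is a covering $\mathcal{F}$ of $\mathcal{X}$ by open cubes such that: (1) with $\sigma=\min(10/9,(d+1)/d)$, for every $x\in\mathbb{R}^d$, $\sum_{Q\in\mathcal{F}}\chi_{\sigma Q}(x)\le A\,\chi_{\mathcal{X}}(x)$; (2) for some fixed cube $Q_0\in\mathcal{F}$ (the central cube) and every $Q\in\mathcal{F}$ there is a chain $Q_0,Q_1,\dots,Q_N=Q$ of distinct cubes of $\mathcal{F}$ ($N$ may depend on $Q$) such that $Q\subset BQ_j$ for all $j\in\{0,\dots,N-1\}$; (3) consecutive cubes of this chain satisfy $\rho(Q_j\cap Q_{j+1})\ge C^{-1}\max(\rho(Q_j),\rho(Q_{j+1}))$ for all $j\in\{0,\dots,N-1\}$. For a cube $Q$ and $\lambda>0$, $\lambda Q$ is the cube with the same centre and side length multiplied by $\lambda$. $M_{\rho_Q}$ and $m_{\rho_Q}$ denote the (essential) supremum and infimum of the density of $\rho$ on $Q$, with $m_{\rho_Q}>0$. For $\psi\in C_b(\mathcal{Y})$, $\psi^*(x)=\sup_{y\in\mathcal{Y}}\langle x|y\rangle-\psi(y)$ is a convex function on $\mathbb{R}^d$ (differentiable Lebesgue-a.e.), and $\mathcal{K}_\rho(\psi)=\int_{\mathcal{X}}\psi^*\,\mathrm{d}\rho$. $\operatorname{Var}_\rho(f)=\int f^2\,\mathrm{d}\rho-\left(\int f\,\mathrm{d}\rho\right)^2$,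 and $\langle f|\nu\rangle=\int f\,\mathrm{d}\nu$. *)

theory Defs
  imports "HOL-Probability.Probability"
begin

section \<open>Cubes\<close>

text \<open>
  A cube may have any orientation: it is the image of an axis-parallel one under an orthogonal
  map \<open>U\<close>. Cubes are handled as point sets, so that "distinct cubes" means distinct sets.
\<close>

definition open_cube :: "'a::euclidean_space \<Rightarrow> real \<Rightarrow> ('a \<Rightarrow> 'a) \<Rightarrow> 'a set" where
  "open_cube c s U = (\<lambda>x. c + U x) ` box (- (s / 2) *\<^sub>R One) ((s / 2) *\<^sub>R One)"

definition is_cube_centred :: "'a::euclidean_space \<Rightarrow> 'a set \<Rightarrow> bool" where
  "is_cube_centred c Q \<longleftrightarrow>
     (\<exists>s U. 0 < s \<and> orthogonal_transformation U \<and> Q = open_cube c s U)"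

definition is_open_cube :: "'a::euclidean_space set \<Rightarrow> bool" where
  "is_open_cube Q \<longleftrightarrow> (\<exists>c. is_cube_centred c Q)"

definition cube_center :: "'a::euclidean_space set \<Rightarrow> 'a" where
  "cube_center Q = (THE c. is_cube_centred c Q)"

definition dilate :: "real \<Rightarrow> 'a::euclidean_space set \<Rightarrow> 'a set" where
  "dilate r Q = (\<lambda>x. cube_center Q + r *\<^sub>R (x - cube_center Q)) ` Q"

lemma box_symmetric_iff:
  "x \<in> box (- (s / 2) *\<^sub>R One) ((s / 2) *\<^sub>R One)
     \<longleftrightarrow> (\<forall>b\<in>Basis. \<bar>x \<bullet> b\<bar> < s / 2)" for x :: "'a::euclidean_space"
  by (auto simp: mem_box abs_less_iff inner_sum_left_Basis)

lemma open_cube_reflect: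
  assumes U: "orthogonal_transformation U" and y: "y \<in> open_cube c s U"
  shows "2 *\<^sub>R c - y \<in> open_cube c s U"
proof -
  obtain x where x: "x \<in> box (- (s / 2) *\<^sub>R One) ((s / 2) *\<^sub>R One)" "y = c + U x"
    using y unfolding open_cube_def by auto
  have "- x \<in> box (- (s / 2) *\<^sub>R One) ((s / 2) *\<^sub>R One)"
    using x(1) unfolding box_symmetric_iff by simp
  moreover have "2 *\<^sub>R c - y = c + U (- x)"
    using x(2) linear_neg[OF orthogonal_transformation_linear[OF U]] by (simp add: scaleR_2)
  ultimately show ?thesis unfolding open_cube_def by blast
qed

lemma bounded_open_cube:
  assumes U: "orthogonal_transformation U"
  shows "bounded (open_cube c s U)"
proof -
  have "bounded (U ` box (- (s / 2) *\<^sub>R One) ((s / 2) *\<^sub>R One))"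
    by (rule bounded_linear_image)
       (auto simp: linear_conv_bounded_linear[symmetric] orthogonal_transformation_linear[OF U])
  from bounded_translation[OF this, of c] show ?thesis
    by (simp add: open_cube_def image_image)
qed

lemma center_mem_open_cube:
  assumes U: "orthogonal_transformation U" and s: "0 < s"
  shows "c \<in> open_cube c s U"
proof -
  have "0 \<in> box (- (s / 2) *\<^sub>R One) ((s / 2) *\<^sub>R (One::'a))"
    using s unfolding box_symmetric_iff by simp
  moreover have "c = c + U 0"
    using linear_0[OF orthogonal_transformation_linear[OF U]] by simp
  ultimately show ?thesis unfolding open_cube_def by blast
qed

lemma is_cube_centred_unique:
  fixes c c' :: "'a::euclidean_space"
  assumes c: "is_cube_centred c Q" and c': "is_cube_centred c' Q"
  shows "c = c'"
proof (rule ccontr)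
  assume ne: "c \<noteq> c'"
  obtain s U where Q: "0 < s" "orthogonal_transformation U" "Q = open_cube c s U"
    using c unfolding is_cube_centred_def by auto
  obtain s' U' where Q': "orthogonal_transformation U'" "Q = open_cube c' s' U'"
    using c' unfolding is_cube_centred_def by auto
  have shift: "y + 2 *\<^sub>R (c' - c) \<in> Q" if "y \<in> Q" for y
  proof -
    have "2 *\<^sub>R c - y \<in> Q" using open_cube_reflect[OF Q(2)] that Q(3) by simp
    then have "2 *\<^sub>R c' - (2 *\<^sub>R c - y) \<in> Q" using open_cube_reflect[OF Q'(1)] Q'(2) by simp
    then show ?thesis by (simp add: algebra_simps)
  qed
  have mem: "c + real n *\<^sub>R (2 *\<^sub>R (c' - c)) \<in> Q" for n
  proof (induction n)
    case 0
    show ?case using center_mem_open_cube[OF Q(2,1)] Q(3) by simp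
  next
    case (Suc n)
    from shift[OF this] show ?case by (simp add: algebra_simps)
  qed
  obtain R where R: "\<And>y. y \<in> Q \<Longrightarrow> dist c y \<le> R"
    using bounded_open_cube[OF Q(2)] Q(3) unfolding bounded_any_center[where a = c] by blast
  obtain n :: nat where n: "R < real n * norm (2 *\<^sub>R (c' - c))"
    using ex_less_of_nat_mult[of "norm (2 *\<^sub>R (c' - c))" R] ne by auto
  show False using R[OF mem[of n]] n by (simp add: dist_norm)
qed

lemma cube_center_eq: "is_cube_centred c Q \<Longrightarrow> cube_center Q = c"
  unfolding cube_center_def by (blast intro: the_equality is_cube_centred_unique)

lemma dilate_open_cube:
  assumes U: "orthogonal_transformation U" and s: "0 < s" and l: "0 < l"
  shows "dilate l (open_cube c s U) = open_cube c (l * s) U"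
proof -
  have cc: "cube_center (open_cube c s U) = c"
    using U s by (intro cube_center_eq) (auto simp: is_cube_centred_def)
  have lin: "U (l *\<^sub>R x) = l *\<^sub>R U x" for l x
    using linear_scale[OF orthogonal_transformation_linear[OF U]] .
  have "x \<in> (\<lambda>x. l *\<^sub>R x) ` box (- (s / 2) *\<^sub>R One) ((s / 2) *\<^sub>R One)
          \<longleftrightarrow> x \<in> box (- (l * s / 2) *\<^sub>R One) ((l * s / 2) *\<^sub>R One)" (is "?L \<longleftrightarrow> ?R") for x
  proof
    assume "?L"
    then obtain z where z: "z \<in> box (- (s / 2) *\<^sub>R One) ((s / 2) *\<^sub>R One)" "x = l *\<^sub>R z"
      by blast
    have "\<forall>b\<in>Basis. \<bar>z \<bullet> b\<bar> < s / 2" using z(1) unfolding box_symmetric_iff .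
    then show "?R" using l z(2) unfolding box_symmetric_iff by (auto simp: abs_mult)
  next
    assume "?R"
    then have "(1 / l) *\<^sub>R x \<in> box (- (s / 2) *\<^sub>R One) ((s / 2) *\<^sub>R One)"
      using l unfolding box_symmetric_iff by (auto simp: abs_mult field_simps)
    moreover have "x = l *\<^sub>R ((1 / l) *\<^sub>R x)" using l by simp
    ultimately show "?L" by blast
  qed
  then have box: "(\<lambda>x. l *\<^sub>R x) ` box (- (s / 2) *\<^sub>R One) ((s / 2) *\<^sub>R One)
      = box (- (l * s / 2) *\<^sub>R One) ((l * s / 2) *\<^sub>R (One::'a))" by blast
  show ?thesis
    unfolding dilate_def cc unfolding open_cube_def box[symmetric] by (simp add: image_image lin)
qed

section \<open>Densities and the Boman chain condition\<close>

definition prob_density_on :: "'a::euclidean_space set \<Rightarrow> ('a \<Rightarrow> real) \<Rightarrow> bool" where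
  "prob_density_on X f \<longleftrightarrow>
     f \<in> borel_measurable borel \<and> (\<forall>x. 0 \<le> f x) \<and> (\<forall>x. x \<notin> X \<longrightarrow> f x = 0) \<and>
     (\<integral>\<^sup>+ x. ennreal (f x) \<partial>lborel) = 1"

definition dens_measure :: "('a::euclidean_space \<Rightarrow> real) \<Rightarrow> 'a measure" where
  "dens_measure f = density lborel (\<lambda>x. ennreal (f x))"

text \<open>The counterpart of \<^const>\<open>esssup\<close>, which the library lacks.\<close>

definition essinf :: "'a measure \<Rightarrow>
    ('a \<Rightarrow> 'b::{second_countable_topology, dense_linorder, linorder_topology, complete_linorder}) \<Rightarrow> 'b"
  where "essinf M f = (if f \<in> borel_measurable M then Liminf (ae_filter M) f else bot)"

definition dens_sup :: "('a::euclidean_space \<Rightarrow> real) \<Rightarrow> 'a set \<Rightarrow> ennreal" where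
  "dens_sup f Q = esssup (restrict_space lborel Q) (\<lambda>x. ennreal (f x))"

definition dens_inf :: "('a::euclidean_space \<Rightarrow> real) \<Rightarrow> 'a set \<Rightarrow> ennreal" where
  "dens_inf f Q = essinf (restrict_space lborel Q) (\<lambda>x. ennreal (f x))"

text \<open>
  A chain \<open>Q\<^sub>0, \<dots>, Q\<^sub>N\<close> is a function \<open>P\<close> on the naturals of which only the values on \<open>{..N}\<close>
  matter. The overlap sum runs over a possibly infinite family and is therefore taken in
  \<^typ>\<open>ennreal\<close>, where it always converges unconditionally (possibly to infinity).
\<close>

definition boman_chain ::
    "'a::euclidean_space measure \<Rightarrow> 'a set \<Rightarrow> 'a set set \<Rightarrow> real \<Rightarrow> real \<Rightarrow> real \<Rightarrow> bool" where
  "boman_chain \<rho> X F A B C \<longleftrightarrow>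
     1 < A \<and> 1 < B \<and> 1 < C \<and>
     (\<forall>Q\<in>F. is_open_cube Q) \<and> X \<subseteq> \<Union>F \<and>
     (let \<sigma> = min (10 / 9) ((real DIM('a) + 1) / real DIM('a)) in
       \<forall>x. (\<Sum>\<^sub>\<infinity>Q\<in>F. (indicator (dilate \<sigma> Q) x :: ennreal)) \<le> ennreal A * indicator X x) \<and>
     (\<exists>Q0\<in>F. \<forall>Q\<in>F. \<exists>(N::nat) P.
        P 0 = Q0 \<and> P N = Q \<and> (\<forall>j\<le>N. P j \<in> F) \<and> inj_on P {..N} \<and>
        (\<forall>j<N. Q \<subseteq> dilate B (P j)) \<and>
        (\<forall>j<N. measure \<rho> (P j \<inter> P (Suc j))
                 \<ge> inverse C * max (measure \<rho> (P j)) (measure \<rho> (P (Suc j)))))"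

section \<open>Conjugates and the Kantorovich functional\<close>

definition C_b :: "'a::euclidean_space set \<Rightarrow> ('a \<Rightarrow> real) set" where
  "C_b Y = {\<psi>. continuous_on Y \<psi> \<and> bounded (\<psi> ` Y)}"

definition conjugate :: "'a::euclidean_space set \<Rightarrow> ('a \<Rightarrow> real) \<Rightarrow> 'a \<Rightarrow> real" where
  "conjugate Y \<psi> x = (SUP y\<in>Y. x \<bullet> y - \<psi> y)"

text \<open>
  The value 0 where \<open>f\<close> is not differentiable is a convention; for a convex function it only
  concerns a Lebesgue null set.
\<close>

definition gradient :: "('a::euclidean_space \<Rightarrow> real) \<Rightarrow> 'a \<Rightarrow> 'a" where
  "gradient f x = (if f differentiable (at x) then (THE g. GDERIV f x :> g) else 0)"

lemma gradient_eq:
  assumes "GDERIV f x :> g"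
  shows "gradient f x = g"
proof -
  have "f differentiable (at x)"
    using assms unfolding gderiv_def differentiable_def by blast
  moreover have "(THE g. GDERIV f x :> g) = g"
  proof (rule the_equality)
    show "GDERIV f x :> g" by (rule assms)
  next
    fix g' assume "GDERIV f x :> g'"
    then have "(\<lambda>h. h \<bullet> g') = (\<lambda>h. h \<bullet> g)"
      using assms has_derivative_unique unfolding gderiv_def by blast
    then show "g' = g" by (metis inner_commute vector_eq_rdot)
  qed
  ultimately show ?thesis unfolding gradient_def by simp
qed

definition kantorovich :: "'a::euclidean_space measure \<Rightarrow> 'a set \<Rightarrow> 'a set \<Rightarrow> ('a \<Rightarrow> real) \<Rightarrow> real"
  where "kantorovich \<rho> X Y \<psi> = (LINT x:X|\<rho>. conjugate Y \<psi> x)"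

definition Var :: "'a measure \<Rightarrow> ('a \<Rightarrow> real) \<Rightarrow> real" where
  "Var \<rho> f = (LINT x|\<rho>. (f x)\<^sup>2) - (LINT x|\<rho>. f x)\<^sup>2"

end

theory Submission
  imports Defs
begin

text \<open>
  Write \<open>\<phi>\<^sub>i\<close> for the conjugate of \<open>\<psi>\<^sub>i\<close> and \<open>v = \<phi>\<^sub>1 - \<phi>\<^sub>0\<close>. The right-hand side is the integral
  of \<open>d = \<phi>\<^sub>1 - \<phi>\<^sub>0 + (\<psi>\<^sub>1 - \<psi>\<^sub>0) \<circ> \<nabla>\<phi>\<^sub>0\<close>, and the definition of the conjugates gives, almost
  everywhere and for every shift \<open>w\<close>,
  \<open>d(z) \<ge> \<phi>\<^sub>1(z) - \<phi>\<^sub>1(z - w) + \<phi>\<^sub>0(z) - \<phi>\<^sub>0(z + w)\<close>. Integrating this along a segment from \<open>x\<close> to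
  \<open>y\<close>, with \<open>w\<close> a small multiple of \<open>y - x\<close>, nearly telescopes: as the \<open>\<phi>\<^sub>i\<close> are Lipschitz, the best
  multiple bounds \<open>(v(y) - v(x))\<^sup>2\<close> by a constant times the mean of \<open>d\<close> on the segment. Averaging over
  pairs of points of a cube \<open>Q\<close> controls the oscillation of \<open>v\<close> on \<open>Q\<close> by the integral of \<open>d\<close> over
  \<open>Q\<close>. The Boman chains turn these local estimates into a global one: the dilated cubes are handled by
  a Carleson embedding, proved by a Vitali selection, layer-cake integration and the doubling
  hypothesis.
\<close>

section \<open>Conjugates over a compact set\<close>

text \<open>The integrand \<open>d\<close> makes sense only off a null set, and a segment is itself
  null, so an almost everywhere inequality cannot be integrated along it. Hence the lower bound must
  hold at every point and involve the \<open>\<phi>\<^sub>i\<close> alone. The shifted points may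
  leave the cube and even \<open>X\<close>; this is harmless, as the conjugates are Lipschitz on the
  whole space, with the radius \<open>R\<close> of \<open>Y\<close> as constant. On a segment of
  length at most \<open>L\<close>, a shift by the fraction \<open>h\<close> yields at least
  \<open>h * \<delta> - 4 * R * L * h\<^sup>2\<close>, where \<delta> is the increment of
  \<open>v\<close>; the best \<open>h\<close> gives \<open>\<delta>\<^sup>2 / (16 * R * L)\<close>.

  Chains have no bounded length, so the jumps between local constants cannot be summed by
  Cauchy-Schwarz. But a point of \<open>Q\<close> lies in the dilates of all the distinct cubes of
  the chain of \<open>Q\<close>. The total jump there is at most a multiple of the sum of
  \<open>a P * indicator (dilate B P)\<close>, where \<open>a P\<close> is the root mean square
  oscillation on \<open>P\<close>. What remains is an L2 bound for this sum that does not depend on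
  the number of cubes. It is proved for finite families, where every norm is finite, and the limit
  is taken last.\<close>

locale compact_conjugate =
  fixes Y :: "'a::euclidean_space set" and \<psi> :: "'a \<Rightarrow> real"
  assumes compact_Y: "compact Y" and Y_nonempty: "Y \<noteq> {}" and cont: "continuous_on Y \<psi>"
begin

abbreviation \<phi> :: "'a \<Rightarrow> real" where "\<phi> \<equiv> conjugate Y \<psi>"

text \<open>Acts as a multivalued gradient of \<phi>: its elements are subgradients, its graph is
  closed, and \<phi> is differentiable exactly where it has a single value.\<close>

definition maximizers :: "'a \<Rightarrow> 'a set" where
  "maximizers z = {y \<in> Y. \<phi> z = z \<bullet> y - \<psi> y}"

lemma attained: "\<exists>y\<in>Y. \<forall>y'\<in>Y. z \<bullet> y' - \<psi> y' \<le> z \<bullet> y - \<psi> y"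
  by (rule continuous_attains_sup) (auto intro!: continuous_intros compact_Y Y_nonempty cont)

lemma bdd: "bdd_above ((\<lambda>y. z \<bullet> y - \<psi> y) ` Y)"
  using attained[of z] by (auto simp: bdd_above_def)

lemma conjugate_ge: "y \<in> Y \<Longrightarrow> z \<bullet> y - \<psi> y \<le> \<phi> z"
  unfolding conjugate_def by (rule cSUP_upper[OF _ bdd])

lemma maximizers_nonempty: "\<exists>y. y \<in> maximizers z"
proof -
  obtain y where y: "y \<in> Y" "\<And>y'. y' \<in> Y \<Longrightarrow> z \<bullet> y' - \<psi> y' \<le> z \<bullet> y - \<psi> y"
    using attained by blast
  have "\<phi> z \<le> z \<bullet> y - \<psi> y"
    unfolding conjugate_def by (rule cSUP_least) (use y Y_nonempty in auto)
  then show ?thesis using conjugate_ge[OF y(1), of z] y(1) by (auto simp: maximizers_def)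
qed

lemma conjugate_subgradient: "y \<in> maximizers z \<Longrightarrow> \<phi> z + h \<bullet> y \<le> \<phi> (z + h)"
  using conjugate_ge[of y "z + h"] by (auto simp: maximizers_def inner_add_left)

lemma maximizers_monotone:
  assumes "y \<in> maximizers z" "y' \<in> maximizers z'"
  shows "0 \<le> (z' - z) \<bullet> (y' - y)"
  using conjugate_subgradient[OF assms(1), of "z' - z"] conjugate_subgradient[OF assms(2), of "z - z'"]
  by (simp add: inner_diff_left inner_diff_right)

lemma conjugate_diff_le:
  assumes "\<And>y. y \<in> Y \<Longrightarrow> norm y \<le> R"
  shows "\<phi> x - \<phi> z \<le> R * norm (x - z)"
proof -
  obtain y where y: "y \<in> maximizers x" using maximizers_nonempty by blast
  have "\<phi> x - \<phi> z \<le> (x - z) \<bullet> y"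
    using conjugate_subgradient[OF y, of "z - x"] by (simp add: inner_diff_left)
  also have "\<dots> \<le> norm (x - z) * norm y" by (rule norm_cauchy_schwarz)
  also have "\<dots> \<le> norm (x - z) * R"
    using assms y by (intro mult_left_mono) (auto simp: maximizers_def)
  finally show ?thesis by (simp add: mult.commute)
qed

lemma conjugate_lipschitz:
  assumes "\<And>y. y \<in> Y \<Longrightarrow> norm y \<le> R"
  shows "\<bar>\<phi> x - \<phi> z\<bar> \<le> R * norm (x - z)"
  using conjugate_diff_le[OF assms, of x z] conjugate_diff_le[OF assms, of z x]
  by (simp add: abs_le_iff norm_minus_commute)

lemma continuous_conjugate: "continuous_on S \<phi>"
proof -
  obtain R where R: "0 < R" "\<And>y. y \<in> Y \<Longrightarrow> norm y \<le> R"
    using compact_imp_bounded[OF compact_Y] by (auto simp: bounded_pos)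
  have "R-lipschitz_on S \<phi>"
    using conjugate_lipschitz[OF R(2)] R(1)
    by (intro lipschitz_onI) (auto simp: dist_norm)
  then show ?thesis by (rule lipschitz_on_continuous_on)
qed

text \<open>The pairs \<open>(y, z)\<close> with \<open>y\<close> a maximizer at \<open>z\<close>
  form a closed set, and projecting away the compact factor \<open>Y\<close> preserves closedness.
  This serves twice: as upper semicontinuity in the differentiability proof and as Borel
  measurability of the gradient.\<close>

lemma closed_graph_set:
  assumes "closed C"
  shows "closed {z. \<exists>y. y \<in> maximizers z \<and> y \<in> C}"
proof -
  let ?U = "{w \<in> Y \<times> (UNIV::'a set). \<phi> (snd w) - snd w \<bullet> fst w + \<psi> (fst w) = 0}"
  let ?V = "(Y \<inter> C) \<times> (UNIV::'a set)"
  have "continuous_on (Y \<times> (UNIV::'a set)) (\<lambda>w. \<phi> (snd w) - snd w \<bullet> fst w + \<psi> (fst w))"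
    by (intro continuous_intros continuous_on_compose2[OF continuous_conjugate[of UNIV]]
        continuous_on_compose2[OF cont]) auto
  then have "closedin (top_of_set (Y \<times> UNIV)) ?U"
    by (rule continuous_closedin_preimage_constant)
  moreover have "closed (Y \<times> (UNIV::'a set))"
    by (simp add: closed_Times compact_imp_closed compact_Y)
  ultimately have "closed ?U" using closedin_closed_trans by blast
  then have "closed (?U \<inter> ?V)"
    by (intro closed_Int closed_Times) (auto simp: compact_imp_closed compact_Y assms)
  then have "closedin (top_of_set (Y \<times> UNIV)) (?U \<inter> ?V)"
    by (rule closed_subset[rotated]) auto
  from closedin_compact_projection[OF compact_Y this]
  have "closed {z. \<exists>y. y \<in> Y \<and> (y, z) \<in> ?U \<inter> ?V}" by simp
  also have "{z. \<exists>y. y \<in> Y \<and> (y, z) \<in> ?U \<inter> ?V} = {z. \<exists>y. y \<in> maximizers z \<and> y \<in> C}"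
    by (auto simp: maximizers_def algebra_simps)
  finally show ?thesis .
qed

text \<open>The points whose maximizers spread across the gap from \<open>p\<close> to
  \<open>q\<close> in direction \<open>b\<close>. These conditions are closed, and rational
  \<open>p < q\<close> suffice to detect non-uniqueness.\<close>

definition kinks :: "'a \<Rightarrow> real \<Rightarrow> real \<Rightarrow> 'a set" where
  "kinks b p q = {z. \<exists>y. y \<in> maximizers z \<and> y \<bullet> b \<le> p} \<inter> {z. \<exists>y. y \<in> maximizers z \<and> q \<le> y \<bullet> b}"

lemma closed_kinks: "closed (kinks b p q)"
proof -
  have "closed {y. y \<bullet> b \<le> p}" "closed {y. q \<le> y \<bullet> b}"
    by (auto intro!: closed_Collect_le continuous_intros)
  from this[THEN closed_graph_set] show ?thesis
    unfolding kinks_def by (intro closed_Int) auto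
qed

text \<open>By monotonicity the component along \<open>b\<close> cannot decrease between maximizers
  when moving in direction \<open>b\<close>: from a value at least \<open>q\<close> one never
  reaches a value at most \<open>p < q\<close> further on.\<close>

lemma kinks_line:
  assumes "p < q" "z \<in> kinks b p q" "z + t *\<^sub>R b \<in> kinks b p q"
  shows "t = 0"
proof -
  have *: "t \<le> 0" if zt: "z \<in> kinks b p q" "z + t *\<^sub>R b \<in> kinks b p q" for z t
  proof (rule ccontr)
    assume "\<not> t \<le> 0"
    obtain y y' where y: "y \<in> maximizers z" "q \<le> y \<bullet> b"
      and y': "y' \<in> maximizers (z + t *\<^sub>R b)" "y' \<bullet> b \<le> p"
      using zt unfolding kinks_def by blast
    have "0 \<le> t * (y' \<bullet> b - y \<bullet> b)"
      using maximizers_monotone[OF y(1) y'(1)] by (simp add: inner_diff_right inner_commute)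
    then show False using \<open>\<not> t \<le> 0\<close> y y' \<open>p < q\<close> by (simp add: zero_le_mult_iff)
  qed
  show ?thesis using *[of z t] *[of "z + t *\<^sub>R b" "- t"] assms by simp
qed

end

text \<open>The translates of a bounded part of \<open>N\<close> by \<open>b / (n + 1)\<close> are disjoint and stay in a bounded set.\<close>

lemma null_if_meets_lines_once:
  fixes N :: "'a::euclidean_space set"
  assumes N: "N \<in> sets borel" and b: "norm b = 1"
    and line: "\<And>z t. z \<in> N \<Longrightarrow> z + t *\<^sub>R b \<in> N \<Longrightarrow> t = 0"
  shows "N \<in> null_sets lborel"
proof -
  have bounded_case: "emeasure lborel (N \<inter> ball 0 (real r)) = 0" for r :: nat
  proof -
    define S where "S = N \<inter> ball 0 (real r)"
    define T where "T n = (\<lambda>x. x + (1 / real (Suc n)) *\<^sub>R b) ` S" for n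
    have S: "S \<in> sets borel" using N by (auto simp: S_def)
    have Tpre: "T n = (\<lambda>x. x - (1 / real (Suc n)) *\<^sub>R b) -` S \<inter> space borel" for n
    proof -
      have "x \<in> T n" if "x - (1 / real (Suc n)) *\<^sub>R b \<in> S" for x
        unfolding T_def using that by (intro image_eqI[of _ _ "x - (1 / real (Suc n)) *\<^sub>R b"]) auto
      then show ?thesis by (auto simp: T_def)
    qed
    have T: "T n \<in> sets lborel" for n
      unfolding Tpre sets_lborel by (rule measurable_sets[OF _ S]) simp
    have em: "emeasure lborel (T n) = emeasure lborel S" for n
    proof -
      have "emeasure lebesgue (T n) = emeasure lebesgue S"
        unfolding T_def using emeasure_lebesgue_affine[of 1 "(1 / real (Suc n)) *\<^sub>R b" S]
        by (simp del: of_nat_Suc)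
      then show ?thesis using T S by (simp add: sets_lborel)
    qed
    have disj: "disjoint_family T"
      unfolding disjoint_family_on_def
    proof (intro ballI impI, rule ccontr)
      fix m n assume "m \<noteq> n" "T m \<inter> T n \<noteq> {}"
      then obtain x y where xy: "x \<in> N" "y \<in> N"
        "x + (1 / real (Suc m)) *\<^sub>R b = y + (1 / real (Suc n)) *\<^sub>R b"
        by (auto simp: T_def S_def simp del: of_nat_Suc)
      then have "y = x + (1 / real (Suc m) - 1 / real (Suc n)) *\<^sub>R b"
        by (simp add: algebra_simps)
      then have "1 / real (Suc m) - 1 / real (Suc n) = 0" using line xy by blast
      then show False using \<open>m \<noteq> n\<close> by simp
    qed
    have sub: "(\<Union>n. T n) \<subseteq> ball 0 (real r + 1)"
    proof
      fix x assume "x \<in> (\<Union>n. T n)"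
      then obtain n y where y: "y \<in> S" "x = y + (1 / real (Suc n)) *\<^sub>R b" by (auto simp: T_def)
      have "norm x \<le> norm y + norm ((1 / real (Suc n)) *\<^sub>R b)"
        unfolding y(2) by (rule norm_triangle_ineq)
      also have "norm ((1 / real (Suc n)) *\<^sub>R b) \<le> 1" using b by simp
      finally show "x \<in> ball 0 (real r + 1)" using y(1) by (auto simp: S_def)
    qed
    have "(\<Sum>n. emeasure lborel (T n)) = emeasure lborel (\<Union>n. T n)"
      by (rule suminf_emeasure) (use T disj in auto)
    also have "\<dots> \<le> emeasure lborel (ball (0::'a) (real r + 1))"
      by (rule emeasure_mono[OF sub]) auto
    also have "\<dots> < \<infinity>" by (intro emeasure_bounded_finite) auto
    finally have "(\<Sum>n::nat. emeasure lborel S) < \<infinity>" by (simp add: em)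
    moreover have "(\<Sum>n::nat. emeasure lborel S) = emeasure lborel S * \<infinity>"
      using nn_integral_count_space_nat[of "\<lambda>_. emeasure lborel S"] by simp
    ultimately show ?thesis unfolding S_def[symmetric]
      by (auto simp: ennreal_mult_top split: if_splits)
  qed
  have "emeasure lborel (\<Union>r::nat. N \<inter> ball 0 (real r)) = 0"
    by (rule emeasure_UN_eq_0) (use N bounded_case in auto)
  moreover have "(\<Union>r::nat. N \<inter> ball 0 (real r)) = N"
    by (auto, metis real_arch_simple reals_Archimedean2)
  ultimately show ?thesis using N by (auto intro!: null_setsI)
qed

section \<open>Almost everywhere differentiability of the conjugate and its gradient map\<close>

context compact_conjugate
begin

text \<open>The points with several maximizers, encoded so that nullness and Borel measurability
  follow from those of countably many \<open>kinks\<close>.\<close>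

definition singular :: "'a set" where
  "singular = (\<Union>b\<in>Basis. \<Union>p\<in>\<rat>. \<Union>q\<in>{q\<in>\<rat>. p < q}. kinks b p q)"

lemma singular_eq: "singular = {z. \<exists>y y'. y \<in> maximizers z \<and> y' \<in> maximizers z \<and> y \<noteq> y'}"
proof (intro equalityI subsetI)
  fix z assume "z \<in> singular"
  then obtain b p q where "p < q" "z \<in> kinks b p q" unfolding singular_def by blast
  then show "z \<in> {z. \<exists>y y'. y \<in> maximizers z \<and> y' \<in> maximizers z \<and> y \<noteq> y'}"
    unfolding kinks_def by fastforce
next
  fix z assume "z \<in> {z. \<exists>y y'. y \<in> maximizers z \<and> y' \<in> maximizers z \<and> y \<noteq> y'}"
  then obtain y y' where y: "y \<in> maximizers z" "y' \<in> maximizers z" "y \<noteq> y'" by blast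
  then obtain b where b: "b \<in> Basis" "y \<bullet> b \<noteq> y' \<bullet> b"
    using euclidean_eqI[of y y'] by blast
  have *: "z \<in> singular" if uv: "u \<in> maximizers z" "v \<in> maximizers z" "u \<bullet> b < v \<bullet> b" for u v
  proof -
    obtain p where p: "p \<in> \<rat>" "u \<bullet> b < p" "p < v \<bullet> b" using Rats_dense_in_real[OF uv(3)] by blast
    obtain q where q: "q \<in> \<rat>" "p < q" "q < v \<bullet> b" using Rats_dense_in_real[OF p(3)] by blast
    have "z \<in> kinks b p q" unfolding kinks_def
      using uv p q by (auto intro: less_imp_le)
    then show ?thesis unfolding singular_def using b(1) p(1) q(1,2) by blast
  qed
  show "z \<in> singular" using *[of y y'] *[of y' y] y b by (auto simp: neq_iff)
qed

lemma singular_null: "singular \<in> null_sets lborel"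
proof -
  have "kinks b p q \<in> null_sets lborel" if b: "b \<in> Basis" and pq: "p < q" for b p q
    by (rule null_if_meets_lines_once[of _ b])
       (use kinks_line[OF pq] closed_kinks b in auto)
  then show ?thesis
    unfolding singular_def
    by (intro null_sets_UN' countable_Collect) (auto intro!: countable_rat countable_subset[OF _ countable_rat] countable_finite)
qed

lemma maximizers_unique:
  "z \<notin> singular \<Longrightarrow> y \<in> maximizers z \<Longrightarrow> y' \<in> maximizers z \<Longrightarrow> y = y'"
  by (auto simp: singular_eq)

text \<open>Subtracting the linear function given by \<open>y\<close> leaves a function with a
  global minimum at \<open>z\<close>, whose derivative must vanish there.\<close>

lemma GDERIV_imp_maximizer:
  assumes g: "GDERIV \<phi> z :> g" and y: "y \<in> maximizers z"
  shows "g = y"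
proof -
  have "((\<lambda>x. \<phi> x - x \<bullet> y) has_derivative (\<lambda>h. h \<bullet> g - h \<bullet> y)) (at z)"
    using g unfolding gderiv_def by (auto intro!: derivative_eq_intros)
  moreover have "\<phi> z - z \<bullet> y \<le> \<phi> x - x \<bullet> y" for x
    using conjugate_subgradient[OF y, of "x - z"] by (simp add: inner_diff_left)
  ultimately have "(\<lambda>h. h \<bullet> g - h \<bullet> y) = (\<lambda>h. 0)"
    using differential_zero_maxmin[of z UNIV] by blast
  then have "h \<bullet> (g - y) = 0" for h by (metis inner_diff_right)
  from this[of "g - y"] show ?thesis by simp
qed

text \<open>Near \<open>z\<close> every maximizer is within \<open>e\<close> of \<open>y\<close>, by
  closedness of the graph. The subgradient inequalities at \<open>z\<close> and at the nearby point
  \<open>x\<close> then squeeze the increment of \<phi> between \<open>(x - z) \<bullet> y\<close>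
  and the same value plus \<open>e * norm (x - z)\<close>.\<close>

lemma GDERIV_if_regular:
  assumes z: "z \<notin> singular" and y: "y \<in> maximizers z"
  shows "GDERIV \<phi> z :> y"
  unfolding gderiv_def has_derivative_at_alt
proof (intro conjI allI impI)
  show "bounded_linear (\<lambda>h. h \<bullet> y)" by (rule bounded_linear_inner_left)
  fix e :: real assume "0 < e"
  define W where "W = {x. \<exists>w. w \<in> maximizers x \<and> w \<in> - ball y e}"
  have "closed W" unfolding W_def by (rule closed_graph_set) auto
  moreover have "z \<notin> W"
    using maximizers_unique[OF z y] \<open>0 < e\<close> by (auto simp: W_def)
  ultimately obtain d where d: "0 < d" "ball z d \<subseteq> - W"
    by (metis open_Compl ComplI open_contains_ball)
  show "\<exists>d>0. \<forall>x. norm (x - z) < d \<longrightarrow> norm (\<phi> x - \<phi> z - (x - z) \<bullet> y) \<le> e * norm (x - z)"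
  proof (intro exI conjI allI impI)
    show "0 < d" by (rule d)
    fix x assume "norm (x - z) < d"
    then have "x \<in> ball z d" by (simp add: dist_norm norm_minus_commute)
    then have "x \<notin> W" using d(2) by blast
    obtain w where w: "w \<in> maximizers x" using maximizers_nonempty by blast
    with \<open>x \<notin> W\<close> have "norm (w - y) < e" by (auto simp: W_def dist_norm norm_minus_commute)
    have "(x - z) \<bullet> (w - y) \<le> norm (x - z) * norm (w - y)" by (rule norm_cauchy_schwarz)
    also have "\<dots> \<le> norm (x - z) * e" using \<open>norm (w - y) < e\<close> by (intro mult_left_mono) auto
    finally have "(x - z) \<bullet> (w - y) \<le> e * norm (x - z)" by (simp add: mult.commute)
    moreover have "\<phi> z + (x - z) \<bullet> y \<le> \<phi> x" using conjugate_subgradient[OF y, of "x - z"] by simp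
    moreover have "\<phi> x - (x - z) \<bullet> w \<le> \<phi> z"
      using conjugate_subgradient[OF w, of "z - x"] by (simp add: inner_diff_left)
    ultimately show "norm (\<phi> x - \<phi> z - (x - z) \<bullet> y) \<le> e * norm (x - z)"
      by (simp add: inner_diff_right)
  qed
qed

lemma gradient_regular: "z \<notin> singular \<Longrightarrow> gradient \<phi> z \<in> maximizers z"
  using gradient_eq[OF GDERIV_if_regular] maximizers_nonempty by metis

text \<open>A derivative at such a point would equal two different maximizers, so
  \<open>gradient\<close> takes its default value. Knowing this value on the null set makes
  \<open>gradient\<close> Borel, not merely measurable up to a null set.\<close>

lemma gradient_singular:
  assumes "z \<in> singular"
  shows "gradient \<phi> z = 0"
proof -
  have "\<not> \<phi> differentiable (at z)"
  proof
    assume "\<phi> differentiable (at z)"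
    then obtain D where D: "(\<phi> has_derivative D) (at z)" unfolding differentiable_def by blast
    then interpret bounded_linear D by (rule has_derivative_bounded_linear)
    define g where "g = (\<Sum>b\<in>Basis. D b *\<^sub>R b)"
    have "D h = h \<bullet> g" for h
    proof -
      have "D h = D (\<Sum>b\<in>Basis. (h \<bullet> b) *\<^sub>R b)" by (simp add: euclidean_representation)
      also have "\<dots> = h \<bullet> g"
        by (simp only: sum scaleR g_def inner_sum_right inner_scaleR_right)
           (simp add: mult.commute)
      finally show ?thesis .
    qed
    then have "GDERIV \<phi> z :> g" using D unfolding gderiv_def by presburger
    then show False using assms GDERIV_imp_maximizer unfolding singular_eq by blast
  qed
  then show ?thesis by (simp add: gradient_def)
qed

lemma gradient_measurable: "gradient \<phi> \<in> borel_measurable borel"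
proof (rule borel_measurableI)
  fix S :: "'a set" assume "open S"
  define C where "C = - S"
  have "closed C" using \<open>open S\<close> by (simp add: C_def closed_Compl)
  \<comment> \<open>Off \<open>singular\<close> the gradient is the only maximizer, so it lies in
    \<open>C\<close> iff some maximizer does; on \<open>singular\<close> it is the default
    0.\<close>
  have "gradient \<phi> -` C = ({z. \<exists>y. y \<in> maximizers z \<and> y \<in> C} - singular)
      \<union> (if 0 \<in> C then singular else {})"
  proof (intro set_eqI)
    fix z
    show "z \<in> gradient \<phi> -` C \<longleftrightarrow> z \<in> ({z. \<exists>y. y \<in> maximizers z \<and> y \<in> C} - singular)
      \<union> (if 0 \<in> C then singular else {})"
    proof (cases "z \<in> singular")
      case True
      then show ?thesis using gradient_singular[OF True] by simp
    next
      case False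
      then have "(\<exists>y. y \<in> maximizers z \<and> y \<in> C) \<longleftrightarrow> gradient \<phi> z \<in> C"
        using gradient_regular[OF False] maximizers_unique[OF False] by metis
      with False show ?thesis by simp
    qed
  qed
  moreover have "singular \<in> sets borel" using singular_null by auto
  moreover have "{z. \<exists>y. y \<in> maximizers z \<and> y \<in> C} \<in> sets borel"
    using closed_graph_set[OF \<open>closed C\<close>] by auto
  ultimately have "gradient \<phi> -` C \<in> sets borel" by auto
  moreover have "gradient \<phi> -` S = - (gradient \<phi> -` C)" by (auto simp: C_def)
  ultimately show "gradient \<phi> -` S \<inter> space borel \<in> sets borel"
    by (metis borel_comp Int_UNIV_right space_borel)
qed

end

section \<open>The local estimate on a convex set\<close>

lemma continuous_antiderivative_on:
  fixes f :: "real \<Rightarrow> real"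
  assumes "continuous_on UNIV f"
  obtains F where "\<And>x. a < x \<Longrightarrow> x < b \<Longrightarrow> (F has_real_derivative f x) (at x)"
proof -
  obtain F where F: "\<And>x. x \<in> {a..b} \<Longrightarrow> (F has_vector_derivative f x) (at x within {a..b})"
    using antiderivative_continuous[OF continuous_on_subset[OF assms subset_UNIV]] by blast
  have "(F has_real_derivative f x) (at x)" if "a < x" "x < b" for x
    using F[of x] that at_within_interior[of x "{a..b}"]
    by (auto simp: has_real_derivative_iff_has_vector_derivative)
  then show ?thesis using that by blast
qed

text \<open>The mean value theorem writes the increment as \<open>h * f \<xi>\<close> with \<xi>
  within \<open>\<bar>h\<bar>\<close> of \<open>a\<close>. Both signs of \<open>h\<close> are
  covered because the shift used later has the sign of the oscillation.\<close>

lemma antiderivative_increment: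
  fixes f F :: "real \<Rightarrow> real"
  assumes lip: "\<And>s t. \<bar>f s - f t\<bar> \<le> M * \<bar>s - t\<bar>"
    and F: "\<And>x. c < x \<Longrightarrow> x < d \<Longrightarrow> (F has_real_derivative f x) (at x)"
    and ab: "c < a" "a < d" "c < a + h" "a + h < d"
  shows "\<bar>F (a + h) - F a - h * f a\<bar> \<le> M * h\<^sup>2"
proof -
  have M: "0 \<le> M" using order_trans[OF abs_ge_zero lip[of 1 0]] by simp
  have "\<exists>\<xi>. \<bar>\<xi> - a\<bar> \<le> \<bar>h\<bar> \<and> F (a + h) - F a = h * f \<xi>"
  proof (cases h "0 :: real" rule: linorder_cases)
    case less
    then obtain \<xi> where "a + h < \<xi>" "\<xi> < a" "F a - F (a + h) = (a - (a + h)) * f \<xi>"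
      using MVT2[of "a + h" a F f] F ab by force
    then show ?thesis using less by (intro exI[of _ \<xi>]) (auto simp: algebra_simps)
  next
    case equal
    then show ?thesis by (intro exI[of _ a]) auto
  next
    case greater
    then obtain \<xi> where "a < \<xi>" "\<xi> < a + h" "F (a + h) - F a = (a + h - a) * f \<xi>"
      using MVT2[of a "a + h" F f] F ab by force
    then show ?thesis using greater by (intro exI[of _ \<xi>]) auto
  qed
  then obtain \<xi> where \<xi>: "\<bar>\<xi> - a\<bar> \<le> \<bar>h\<bar>" "F (a + h) - F a = h * f \<xi>" by blast
  have "\<bar>F (a + h) - F a - h * f a\<bar> = \<bar>h\<bar> * \<bar>f \<xi> - f a\<bar>"
    by (simp add: \<xi>(2) abs_mult[symmetric] right_diff_distrib)
  also have "\<dots> \<le> \<bar>h\<bar> * (M * \<bar>h\<bar>)"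
    using lip[of \<xi> a] \<xi>(1) M by (intro mult_left_mono) (auto intro: order_trans mult_left_mono)
  finally show ?thesis by (simp add: power2_eq_square mult_ac abs_mult_self_eq)
qed

text \<open>After integration each shift becomes a difference of antiderivatives at the ends 0 and
  1. To first order these add up to \<open>h\<close> times the increment of \<open>f1 - f0\<close>;
  four errors of at most \<open>M * h\<^sup>2\<close> remain.\<close>

lemma gap_integral_unit_interval:
  fixes f0 f1 :: "real \<Rightarrow> real" and g :: "real \<Rightarrow> ennreal"
  assumes M: "0 < M"
    and lip0: "\<And>s t. \<bar>f0 s - f0 t\<bar> \<le> M * \<bar>s - t\<bar>"
    and lip1: "\<And>s t. \<bar>f1 s - f1 t\<bar> \<le> M * \<bar>s - t\<bar>"
    and g: "\<And>t h. ennreal (f1 t - f1 (t - h) + f0 t - f0 (t + h)) \<le> g t"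
  shows "ennreal (((f1 1 - f0 1) - (f1 0 - f0 0))\<^sup>2 / (16 * M))
    \<le> (\<integral>\<^sup>+t. g t * indicator {0..1} t \<partial>lborel)"
proof -
  define \<delta> where "\<delta> = (f1 1 - f0 1) - (f1 0 - f0 0)"
  define h where "h = \<delta> / (8 * M)" \<comment> \<open>maximises \<open>h * \<delta> - 4 * M * h\<^sup>2\<close>\<close>
  have cont: "continuous_on S f" if f: "\<And>s t. \<bar>f s - f t\<bar> \<le> M * \<bar>s - t\<bar>"
    for f :: "real \<Rightarrow> real" and S
  proof -
    have "M-lipschitz_on S f" using f M by (intro lipschitz_onI) (auto simp: dist_real_def)
    then show ?thesis by (rule lipschitz_on_continuous_on)
  qed
  \<comment> \<open>Room for \<open>t\<close>, \<open>t - h\<close> and \<open>t + h\<close> with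
    \<open>t\<close> in the unit interval.\<close>
  define c where "c = \<bar>h\<bar> + 2"
  obtain F0 where F0: "\<And>x. - c < x \<Longrightarrow> x < c \<Longrightarrow> (F0 has_real_derivative f0 x) (at x)"
    using continuous_antiderivative_on[OF cont[OF lip0]] by blast
  obtain F1 where F1: "\<And>x. - c < x \<Longrightarrow> x < c \<Longrightarrow> (F1 has_real_derivative f1 x) (at x)"
    using continuous_antiderivative_on[OF cont[OF lip1]] by blast
  define q where "q t = f1 t - f1 (t - h) + f0 t - f0 (t + h)" for t
  define G where "G t = F1 t - F1 (t - h) + F0 t - F0 (t + h)" for t
  have G: "DERIV G t :> q t" if t: "0 \<le> t" "t \<le> 1" for t
  proof -
    have 1: "DERIV F1 t :> f1 t" "DERIV F1 (t - h) :> f1 (t - h)"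
      "DERIV F0 t :> f0 t" "DERIV F0 (t + h) :> f0 (t + h)"
      using t by (auto intro!: F0 F1 simp: c_def)
    have "DERIV (\<lambda>t. F1 (t - h)) t :> f1 (t - h)" "DERIV (\<lambda>t. F0 (t + h)) t :> f0 (t + h)"
      using 1(2,4) DERIV_shift[of F1 _ t "- h"] DERIV_shift[of F0 _ t h] by simp_all
    then show ?thesis unfolding G_def q_def using 1 by (auto intro!: derivative_intros)
  qed
  have qc: "continuous_on S q" for S
    unfolding q_def
    by (intro continuous_intros continuous_on_compose2[OF cont[OF lip1, of UNIV]]
        continuous_on_compose2[OF cont[OF lip0, of UNIV]]) auto
  have bi: "has_bochner_integral lborel (\<lambda>t. q t * indicator {0..1} t) (G 1 - G 0)"
    by (rule has_bochner_integral_FTC_Icc_real)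
       (use G qc[of UNIV] in \<open>auto simp: continuous_on_eq_continuous_at\<close>)
  have b1: "\<bar>F1 (a + (- h)) - F1 a - (- h) * f1 a\<bar> \<le> M * (- h)\<^sup>2" if "0 \<le> a" "a \<le> 1" for a
    by (rule antiderivative_increment[OF lip1 F1]) (use that in \<open>auto simp: c_def\<close>)
  have b0: "\<bar>F0 (a + h) - F0 a - h * f0 a\<bar> \<le> M * h\<^sup>2" if "0 \<le> a" "a \<le> 1" for a
    by (rule antiderivative_increment[OF lip0 F0]) (use that in \<open>auto simp: c_def\<close>)
  have "\<delta>\<^sup>2 / (16 * M) = h * \<delta> - 4 * (M * h\<^sup>2)"
    using M by (simp add: h_def field_simps power2_eq_square)
  also have "\<dots> = (h * f1 1 - h * f1 0 - h * f0 1 + h * f0 0) - 4 * (M * h\<^sup>2)"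
    by (simp add: \<delta>_def algebra_simps)
  also have "\<dots> \<le> G 1 - G 0" using b0[of 0] b0[of 1] b1[of 0] b1[of 1] unfolding G_def by (simp add: abs_le_iff)
  also have "\<dots> = (\<integral>t. q t * indicator {0..1} t \<partial>lborel)"
    using bi by (simp add: has_bochner_integral_integral_eq)
  finally have "ennreal (\<delta>\<^sup>2 / (16 * M)) \<le> ennreal (\<integral>t. q t * indicator {0..1} t \<partial>lborel)"
    by (rule ennreal_leI)
  \<comment> \<open>The real integrand may be negative; its positive part is what \<open>g\<close>
    dominates.\<close>
  also have "\<dots> \<le> ennreal (\<integral>t. max 0 (q t * indicator {0..1} t) \<partial>lborel)"
    using bi by (intro ennreal_leI integral_mono integrable_max) (auto simp: has_bochner_integral_iff)
  also have "\<dots> = (\<integral>\<^sup>+t. ennreal (max 0 (q t * indicator {0..1} t)) \<partial>lborel)"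
    using bi by (intro nn_integral_eq_integral[symmetric] integrable_max) (auto simp: has_bochner_integral_iff)
  also have "\<dots> \<le> (\<integral>\<^sup>+t. g t * indicator {0..1} t \<partial>lborel)"
  proof (rule nn_integral_mono)
    fix t :: real
    have "ennreal (max 0 (q t)) \<le> g t" using g[of t h] by (simp add: q_def max_def ennreal_neg split: if_splits)
    then show "ennreal (max 0 (q t * indicator {0..1} t)) \<le> g t * indicator {0..1} t"
      by (auto split: split_indicator)
  qed
  finally show ?thesis unfolding \<delta>_def .
qed

text \<open>
  An everywhere defined lower bound, in terms of the conjugates only, for the integrand \<open>d\<close>, which makes
  sense only where \<open>\<phi>0\<close> is differentiable.
\<close>

definition bregman_gap :: "('a::euclidean_space \<Rightarrow> real) \<Rightarrow> ('a \<Rightarrow> real) \<Rightarrow> 'a \<Rightarrow> ennreal" where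
  "bregman_gap \<phi>0 \<phi>1 z = (SUP w. ennreal (\<phi>1 z - \<phi>1 (z - w) + \<phi>0 z - \<phi>0 (z + w)))"

text \<open>The supremum runs over uncountably many shifts, but it is lower semicontinuous: its
  strict superlevel sets are unions of open sets.\<close>

lemma bregman_gap_measurable:
  assumes "continuous_on UNIV \<phi>0" "continuous_on UNIV \<phi>1"
  shows "bregman_gap \<phi>0 \<phi>1 \<in> borel_measurable borel"
proof (rule borel_measurableI_greater)
  fix y :: ennreal
  let ?h = "\<lambda>w z. ennreal (\<phi>1 z - \<phi>1 (z - w) + \<phi>0 z - \<phi>0 (z + w))"
  have "{z. y < bregman_gap \<phi>0 \<phi>1 z} = (\<Union>w. {z. y < ?h w z})"
    by (auto simp: bregman_gap_def less_SUP_iff)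
  moreover have "open {z. y < ?h w z}" for w
    by (intro open_Collect_less continuous_on_ennreal continuous_intros
        continuous_on_compose2[OF assms(1)] continuous_on_compose2[OF assms(2)]) auto
  ultimately show "{z \<in> space borel. y < bregman_gap \<phi>0 \<phi>1 z} \<in> sets borel"
    by (auto intro!: borel_open open_UN)
qed

text \<open>The one-dimensional estimate with shifts along the segment. Parametrised by the unit
  interval, both functions have Lipschitz constant \<open>R * norm (y - x)\<close>, which is where
  the factor \<open>R * L\<close> comes from.\<close>

lemma bregman_gap_segment:
  fixes x y :: "'a::euclidean_space"
  assumes R: "0 < R"
    and lip0: "\<And>x z. \<bar>\<phi>0 x - \<phi>0 z\<bar> \<le> R * norm (x - z)"
    and lip1: "\<And>x z. \<bar>\<phi>1 x - \<phi>1 z\<bar> \<le> R * norm (x - z)"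
    and L: "norm (y - x) \<le> L"
  shows "ennreal (((\<phi>1 y - \<phi>0 y) - (\<phi>1 x - \<phi>0 x))\<^sup>2)
    \<le> ennreal (16 * R * L) *
       (\<integral>\<^sup>+t. bregman_gap \<phi>0 \<phi>1 (x + t *\<^sub>R (y - x)) * indicator {0..1} t \<partial>lborel)"
    (is "ennreal (?d\<^sup>2) \<le> _ * ?I")
proof (cases "x = y")
  case False
  define M where "M = R * norm (y - x)"
  have M: "0 < M" using R False by (simp add: M_def)
  have *: "norm (x + s *\<^sub>R (y - x) - (x + t *\<^sub>R (y - x))) = \<bar>s - t\<bar> * norm (y - x)" for s t
    by (metis add_diff_cancel_left norm_scaleR scaleR_left_diff_distrib)
  have "ennreal (((\<phi>1 (x + 1 *\<^sub>R (y - x)) - \<phi>0 (x + 1 *\<^sub>R (y - x)))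
        - (\<phi>1 (x + 0 *\<^sub>R (y - x)) - \<phi>0 (x + 0 *\<^sub>R (y - x))))\<^sup>2 / (16 * M)) \<le> ?I"
  proof (rule gap_integral_unit_interval[OF M])
    show "\<bar>\<phi>0 (x + s *\<^sub>R (y - x)) - \<phi>0 (x + t *\<^sub>R (y - x))\<bar> \<le> M * \<bar>s - t\<bar>" for s t
      using lip0[of "x + s *\<^sub>R (y - x)" "x + t *\<^sub>R (y - x)"] unfolding * by (simp add: M_def mult_ac)
    show "\<bar>\<phi>1 (x + s *\<^sub>R (y - x)) - \<phi>1 (x + t *\<^sub>R (y - x))\<bar> \<le> M * \<bar>s - t\<bar>" for s t
      using lip1[of "x + s *\<^sub>R (y - x)" "x + t *\<^sub>R (y - x)"] unfolding * by (simp add: M_def mult_ac)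
    fix t h :: real
    have "x + (t - h) *\<^sub>R (y - x) = x + t *\<^sub>R (y - x) - h *\<^sub>R (y - x)"
      "x + (t + h) *\<^sub>R (y - x) = x + t *\<^sub>R (y - x) + h *\<^sub>R (y - x)"
      by (simp_all add: scaleR_left_diff_distrib scaleR_left_distrib)
    then show "ennreal (\<phi>1 (x + t *\<^sub>R (y - x)) - \<phi>1 (x + (t - h) *\<^sub>R (y - x))
        + \<phi>0 (x + t *\<^sub>R (y - x)) - \<phi>0 (x + (t + h) *\<^sub>R (y - x)))
      \<le> bregman_gap \<phi>0 \<phi>1 (x + t *\<^sub>R (y - x))"
      unfolding bregman_gap_def
      by (intro SUP_upper2[of "h *\<^sub>R (y - x)"]) (auto simp: add_diff_eq add.assoc)
  qed
  then have "ennreal (?d\<^sup>2 / (16 * M)) \<le> ?I" by simp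
  then have "ennreal (16 * M) * ennreal (?d\<^sup>2 / (16 * M)) \<le> ennreal (16 * M) * ?I"
    by (rule mult_left_mono) simp
  then have "ennreal (?d\<^sup>2) \<le> ennreal (16 * M) * ?I"
    using M by (simp add: ennreal_mult[symmetric])
  also have "\<dots> \<le> ennreal (16 * R * L) * ?I"
    using L R by (intro mult_right_mono ennreal_leI) (auto simp: M_def)
  finally show ?thesis .
qed simp

text \<open>The homothety of ratio \<open>c\<close> about \<open>y\<close> maps the convex set
  \<open>Q\<close> into itself, and as \<open>c \<ge> 1 / 2\<close> its Jacobian costs at most
  \<open>2 ^ DIM('a)\<close>.\<close>

lemma nn_integral_contraction:
  fixes Q :: "'a::euclidean_space set" and g :: "'a \<Rightarrow> ennreal"
  assumes Q: "convex Q" "Q \<in> sets borel" and g[measurable]: "g \<in> borel_measurable borel"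
    and y: "y \<in> Q" and c: "1 / 2 \<le> c" "c \<le> 1"
  shows "(\<integral>\<^sup>+x. g (y + c *\<^sub>R (x - y)) * indicator Q x \<partial>lborel)
    \<le> 2 ^ DIM('a) * (\<integral>\<^sup>+z. g z * indicator Q z \<partial>lborel)"
proof -
  note [measurable] = Q(2)
  have inQ: "y + c *\<^sub>R (x - y) \<in> Q" if "x \<in> Q" for x
  proof -
    have "(1 - c) *\<^sub>R y + c *\<^sub>R x \<in> Q"
      using Q(1) y that c by (intro convexD_alt) auto
    then show ?thesis by (simp add: algebra_simps)
  qed
  define a where "a = y - c *\<^sub>R y"
  have a: "y + c *\<^sub>R (x - y) = a + c *\<^sub>R x" for x by (simp add: a_def algebra_simps)
  define G where "G z = g z * indicator Q z" for z
  have [measurable]: "G \<in> borel_measurable borel" unfolding G_def by measurable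
  have "(\<integral>\<^sup>+x. g (y + c *\<^sub>R (x - y)) * indicator Q x \<partial>lborel) \<le> (\<integral>\<^sup>+x. G (a + c *\<^sub>R x) \<partial>lborel)"
    using inQ by (intro nn_integral_mono) (auto simp: G_def a split: split_indicator)
  also have "\<dots> \<le> (\<integral>\<^sup>+x. 2 ^ DIM('a) * (ennreal (\<bar>c\<bar> ^ DIM('a)) * G (a + c *\<^sub>R x)) \<partial>lborel)"
  proof (rule nn_integral_mono)
    fix x
    have "1 \<le> (2 * c) ^ DIM('a)" using c by (intro one_le_power) auto
    then have "1 \<le> ennreal (2 ^ DIM('a) * \<bar>c\<bar> ^ DIM('a))"
      using c by (simp add: power_mult_distrib)
    also have "\<dots> = 2 ^ DIM('a) * ennreal (\<bar>c\<bar> ^ DIM('a))"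
      by (simp add: ennreal_mult ennreal_power[symmetric])
    finally have "1 * G (a + c *\<^sub>R x) \<le> 2 ^ DIM('a) * ennreal (\<bar>c\<bar> ^ DIM('a)) * G (a + c *\<^sub>R x)"
      by (rule mult_right_mono) simp
    then show "G (a + c *\<^sub>R x) \<le> 2 ^ DIM('a) * (ennreal (\<bar>c\<bar> ^ DIM('a)) * G (a + c *\<^sub>R x))"
      by (simp add: mult.assoc)
  qed
  also have "\<dots> = 2 ^ DIM('a) * (\<integral>\<^sup>+x. ennreal (\<bar>c\<bar> ^ DIM('a)) * G (a + c *\<^sub>R x) \<partial>lborel)"
    by (simp add: nn_integral_cmult)
  also have "(\<integral>\<^sup>+x. ennreal (\<bar>c\<bar> ^ DIM('a)) * G (a + c *\<^sub>R x) \<partial>lborel) = (\<integral>\<^sup>+z. G z \<partial>lborel)"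
    using c by (subst (2) lborel_affine[of c a]) (auto simp: nn_integral_density nn_integral_distr nn_integral_cmult)
  finally show ?thesis by (simp add: G_def)
qed

text \<open>The segment estimate is averaged over all pairs of points of \<open>Q\<close>. Each
  intermediate point is the image of the nearer endpoint under a homothety about the farther one, of
  ratio at least 1/2, so the contraction bound applies for every \<open>t\<close>. The constant is
  found among the values of \<open>v\<close>.\<close>

lemma local_estimate:
  fixes Q :: "'a::euclidean_space set" and g :: "'a \<Rightarrow> ennreal" and v :: "'a \<Rightarrow> real"
  assumes Q: "convex Q" "Q \<in> sets borel" and g[measurable]: "g \<in> borel_measurable borel"
    and v[measurable]: "v \<in> borel_measurable borel"
    and pos: "emeasure lborel Q \<noteq> 0" "emeasure lborel Q \<noteq> \<infinity>"
    and seg: "\<And>x y. x \<in> Q \<Longrightarrow> y \<in> Q \<Longrightarrow> ennreal ((v y - v x)\<^sup>2)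
      \<le> ennreal K * (\<integral>\<^sup>+t. g (x + t *\<^sub>R (y - x)) * indicator {0..1} t \<partial>lborel)"
  shows "\<exists>c. (\<integral>\<^sup>+x. ennreal ((v x - c)\<^sup>2) * indicator Q x \<partial>lborel)
    \<le> ennreal K * 2 ^ DIM('a) * (\<integral>\<^sup>+z. g z * indicator Q z \<partial>lborel)"
proof (rule ccontr)
  define I where "I = (\<integral>\<^sup>+z. g z * indicator Q z \<partial>lborel)"
  define c0 where "c0 = ennreal K * 2 ^ DIM('a) * I"
  define H where "H x = (\<integral>\<^sup>+y. ennreal ((v y - v x)\<^sup>2) * indicator Q y \<partial>lborel)" for x
  note [measurable] = Q(2)
  have Hm[measurable]: "H \<in> borel_measurable borel" unfolding H_def by measurable
  assume "\<not> ?thesis"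
  \<comment> \<open>The negated goal at the constant \<open>c = v x\<close> makes \<open>H\<close>
    exceed \<open>c0\<close> at every point.\<close>
  then have big: "c0 < H x" for x unfolding c0_def I_def H_def by (auto simp: not_le)
  then have c0: "c0 \<noteq> \<infinity>" by (metis infinity_ennreal_def not_top_less)
  have inner: "(\<integral>\<^sup>+x. (\<integral>\<^sup>+y. g (x + t *\<^sub>R (y - x)) * indicator Q y \<partial>lborel) * indicator Q x \<partial>lborel)
      \<le> 2 ^ DIM('a) * I * emeasure lborel Q" if t: "t \<in> {0..1}" for t
  proof (cases "1 / 2 \<le> t")
    case True
    have "(\<integral>\<^sup>+x. (\<integral>\<^sup>+y. g (x + t *\<^sub>R (y - x)) * indicator Q y \<partial>lborel) * indicator Q x \<partial>lborel)
      \<le> (\<integral>\<^sup>+x. 2 ^ DIM('a) * I * indicator Q x \<partial>lborel)"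
      unfolding I_def using t True
      by (intro nn_integral_mono) (auto split: split_indicator intro!: nn_integral_contraction Q g)
    then show ?thesis by (simp add: nn_integral_cmult_indicator)
  next
    case False
    \<comment> \<open>Seen from \<open>y\<close> the ratio is \<open>1 - t\<close>, again above 1/2;
      Fubini exchanges the roles of \<open>x\<close> and \<open>y\<close>.\<close>
    have flip: "x + t *\<^sub>R (y - x) = y + (1 - t) *\<^sub>R (x - y)" for x y :: 'a by (simp add: algebra_simps)
    have "(\<integral>\<^sup>+x. (\<integral>\<^sup>+y. g (x + t *\<^sub>R (y - x)) * indicator Q y \<partial>lborel) * indicator Q x \<partial>lborel)
      = (\<integral>\<^sup>+x. (\<integral>\<^sup>+y. g (x + t *\<^sub>R (y - x)) * indicator Q y * indicator Q x \<partial>lborel) \<partial>lborel)"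
      by (simp add: nn_integral_multc)
    also have "\<dots> = (\<integral>\<^sup>+y. (\<integral>\<^sup>+x. g (x + t *\<^sub>R (y - x)) * indicator Q y * indicator Q x \<partial>lborel) \<partial>lborel)"
      by (rule lborel_pair.Fubini') measurable
    also have "\<dots> = (\<integral>\<^sup>+y. (\<integral>\<^sup>+x. g (y + (1 - t) *\<^sub>R (x - y)) * indicator Q x * indicator Q y \<partial>lborel) \<partial>lborel)"
      unfolding flip by (simp add: mult_ac)
    also have "\<dots> = (\<integral>\<^sup>+y. (\<integral>\<^sup>+x. g (y + (1 - t) *\<^sub>R (x - y)) * indicator Q x \<partial>lborel) * indicator Q y \<partial>lborel)"
      by (simp add: nn_integral_multc)
    also have "\<dots> \<le> (\<integral>\<^sup>+x. 2 ^ DIM('a) * I * indicator Q x \<partial>lborel)"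
      unfolding I_def using t False
      by (intro nn_integral_mono) (auto split: split_indicator intro!: nn_integral_contraction Q g)
    finally show ?thesis by (simp add: nn_integral_cmult_indicator)
  qed
  have "(\<integral>\<^sup>+x. H x * indicator Q x \<partial>lborel)
    = (\<integral>\<^sup>+x. (\<integral>\<^sup>+y. ennreal ((v y - v x)\<^sup>2) * indicator Q y * indicator Q x \<partial>lborel) \<partial>lborel)"
    unfolding H_def by (simp add: nn_integral_multc)
  also have "\<dots> \<le> (\<integral>\<^sup>+x. (\<integral>\<^sup>+y. ennreal K * (\<integral>\<^sup>+t. g (x + t *\<^sub>R (y - x)) * indicator Q y * indicator Q x * indicator {0..1} t \<partial>lborel) \<partial>lborel) \<partial>lborel)"
    using seg by (intro nn_integral_mono) (auto split: split_indicator)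
  also have "\<dots> = ennreal K * (\<integral>\<^sup>+x. (\<integral>\<^sup>+y. (\<integral>\<^sup>+t. g (x + t *\<^sub>R (y - x)) * indicator Q y * indicator Q x * indicator {0..1} t \<partial>lborel) \<partial>lborel) \<partial>lborel)"
    by (simp add: nn_integral_cmult)
  also have "(\<integral>\<^sup>+x. (\<integral>\<^sup>+y. (\<integral>\<^sup>+t. g (x + t *\<^sub>R (y - x)) * indicator Q y * indicator Q x * indicator {0..1} t \<partial>lborel) \<partial>lborel) \<partial>lborel)
    = (\<integral>\<^sup>+x. (\<integral>\<^sup>+t. (\<integral>\<^sup>+y. g (x + t *\<^sub>R (y - x)) * indicator Q y * indicator Q x * indicator {0..1} t \<partial>lborel) \<partial>lborel) \<partial>lborel)"
    by (intro nn_integral_cong lborel_pair.Fubini') measurable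
  also have "\<dots> = (\<integral>\<^sup>+t. (\<integral>\<^sup>+x. (\<integral>\<^sup>+y. g (x + t *\<^sub>R (y - x)) * indicator Q y * indicator Q x * indicator {0..1} t \<partial>lborel) \<partial>lborel) \<partial>lborel)"
    by (intro lborel_pair.Fubini') measurable
  also have "\<dots> = (\<integral>\<^sup>+t. (\<integral>\<^sup>+x. (\<integral>\<^sup>+y. g (x + t *\<^sub>R (y - x)) * indicator Q y \<partial>lborel) * indicator Q x \<partial>lborel) * indicator {0..1} t \<partial>lborel)"
    by (simp add: nn_integral_multc)
  also have "\<dots> \<le> (\<integral>\<^sup>+t. (2 ^ DIM('a) * I * emeasure lborel Q) * indicator {0..1::real} t \<partial>lborel)"
    using inner by (intro nn_integral_mono) (auto split: split_indicator)
  also have "\<dots> = 2 ^ DIM('a) * I * emeasure lborel Q" by (simp add: nn_integral_cmult_indicator)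
  finally have "(\<integral>\<^sup>+x. H x * indicator Q x \<partial>lborel)
      \<le> ennreal K * (2 ^ DIM('a) * I * emeasure lborel Q)"
    by (simp add: mult_left_mono)
  then have le: "(\<integral>\<^sup>+x. H x * indicator Q x \<partial>lborel) \<le> c0 * emeasure lborel Q"
    by (simp add: c0_def mult.assoc)
  \<comment> \<open>Integrating \<open>c0 < H x\<close> over a set of positive finite measure stays
    strict, since \<open>c0\<close> is finite.\<close>
  have "(\<integral>\<^sup>+x. c0 * indicator Q x \<partial>lborel) < (\<integral>\<^sup>+x. H x * indicator Q x \<partial>lborel)"
  proof (rule nn_integral_less)
    show "(\<integral>\<^sup>+x. c0 * indicator Q x \<partial>lborel) \<noteq> \<infinity>"
      using c0 pos by (simp add: nn_integral_cmult_indicator ennreal_mult_eq_top_iff)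
    show "AE x in lborel. c0 * indicator Q x \<le> H x * indicator Q x"
      using big by (auto split: split_indicator intro: less_imp_le)
    show "\<not> (AE x in lborel. H x * indicator Q x \<le> c0 * indicator Q x)"
    proof
      assume "AE x in lborel. H x * indicator Q x \<le> c0 * indicator Q x"
      then have "AE x in lborel. x \<notin> Q"
        using big by (auto simp: not_le[symmetric] split: split_indicator_asm elim!: eventually_mono)
      then show False using pos(1) AE_iff_measurable[of Q lborel "\<lambda>x. x \<notin> Q"] by auto
    qed
  qed auto
  then show False using le by (simp add: nn_integral_cmult_indicator not_le[symmetric])
qed

section \<open>Gluing along chains\<close>

lemma square_sum_le: "(x + y)\<^sup>2 \<le> 2 * x\<^sup>2 + 2 * (y::real)\<^sup>2"
  using zero_le_power2[of "x - y"] by (simp add: power2_diff power2_sum)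

text \<open>Each \<open>a j\<close> enters at most two consecutive steps, hence the factor
  2.\<close>

lemma telescope_abs_le:
  fixes c a :: "nat \<Rightarrow> real"
  assumes "\<And>j. j < N \<Longrightarrow> \<bar>c (Suc j) - c j\<bar> \<le> \<kappa> * (a j + a (Suc j))"
    and "0 \<le> \<kappa>" "\<And>j. j \<le> N \<Longrightarrow> 0 \<le> a j"
  shows "\<bar>c N - c 0\<bar> \<le> 2 * \<kappa> * (\<Sum>j\<le>N. a j)"
proof -
  have "\<bar>c n - c 0\<bar> \<le> \<kappa> * ((\<Sum>j\<le>n. a j) + (\<Sum>j<n. a j))" if "n \<le> N" for n
    using that
  proof (induction n)
    case 0
    then show ?case using assms(2,3) by auto
  next
    case (Suc n)
    have "\<bar>c (Suc n) - c 0\<bar> \<le> \<bar>c (Suc n) - c n\<bar> + \<bar>c n - c 0\<bar>" by simp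
    also have "\<dots> \<le> \<kappa> * (a n + a (Suc n)) + \<kappa> * ((\<Sum>j\<le>n. a j) + (\<Sum>j<n. a j))"
      using Suc assms(1)[of n] by (intro add_mono) auto
    also have "\<dots> = \<kappa> * ((\<Sum>j\<le>Suc n. a j) + (\<Sum>j<Suc n. a j))"
      by (simp add: algebra_simps)
    finally show ?case .
  qed
  from this[of N] have "\<bar>c N - c 0\<bar> \<le> \<kappa> * ((\<Sum>j\<le>N. a j) + (\<Sum>j<N. a j))" by simp
  also have "\<dots> \<le> \<kappa> * ((\<Sum>j\<le>N. a j) + (\<Sum>j\<le>N. a j))"
    using assms(2,3) by (intro mult_left_mono add_left_mono sum_mono2) auto
  finally show ?thesis by simp
qed

section \<open>The Carleson embedding and the L2 bound for finite families of dilated sets\<close>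

lemma nn_integral_layer:
  assumes "0 \<le> (b::real)"
  shows "(\<integral>\<^sup>+t. ennreal (2 * t) * indicator {0..b} t \<partial>lborel) = ennreal (b\<^sup>2)"
proof -
  have "(\<integral>\<^sup>+t. ennreal (2 * t) * indicator {0..b} t \<partial>lborel) = ennreal (b\<^sup>2 - 0\<^sup>2)"
    using assms by (intro nn_integral_FTC_Icc[where F="\<lambda>t. t\<^sup>2"]) (auto intro!: derivative_eq_intros)
  then show ?thesis by simp
qed

text \<open>For a finite family of cubes, \<open>\<beta>\<close> and \<open>\<gamma>\<close> are the dilations by \<open>B\<close> and \<open>5 * B * sqrt d\<close>.\<close>

locale dilated_family = finite_measure M for M :: "'a measure" +
  fixes G :: "'a set set" and \<beta> \<gamma> :: "'a set \<Rightarrow> 'a set" and radius :: "'a set \<Rightarrow> real" and A D :: real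
  assumes finite_G: "finite G"
    and sets_G [measurable]: "P \<in> G \<Longrightarrow> P \<in> sets M"
    and sets_\<beta> [measurable]: "P \<in> G \<Longrightarrow> \<beta> P \<in> sets M"
    and sets_\<gamma> [measurable]: "P \<in> G \<Longrightarrow> \<gamma> P \<in> sets M"
    and subset_\<beta>: "P \<in> G \<Longrightarrow> P \<subseteq> \<beta> P"
    and \<beta>_subset_\<gamma>: "P \<in> G \<Longrightarrow> \<beta> P \<subseteq> \<gamma> P"
    and measure_pos: "P \<in> G \<Longrightarrow> 0 < measure M P"
    and doubling: "P \<in> G \<Longrightarrow> measure M (\<gamma> P) \<le> D * measure M P"
    and engulf: "\<lbrakk>P \<in> G; P' \<in> G; \<beta> P \<inter> \<beta> P' \<noteq> {}; radius P \<le> radius P'\<rbrakk> \<Longrightarrow> P \<subseteq> \<gamma> P'"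
    and overlap: "(\<Sum>P\<in>G. indicator P x) \<le> A"
    and A_pos: "0 < A" and D_pos: "0 < D"
begin

lemma emeasure_doubling:
  assumes "P \<in> G"
  shows "emeasure M (\<gamma> P) \<le> ennreal D * emeasure M P"
  using doubling[OF assms] D_pos by (simp add: emeasure_eq_measure ennreal_mult[symmetric])

text \<open>The pointwise overlap bound integrated over \<open>T\<close>; it stands in for
  disjointness of the sets of \<open>H\<close>.\<close>

lemma sum_emeasure_le:
  assumes H: "H \<subseteq> G" "\<And>P. P \<in> H \<Longrightarrow> P \<subseteq> T" and T[measurable]: "T \<in> sets M"
  shows "(\<Sum>P\<in>H. emeasure M P) \<le> ennreal A * emeasure M T"
proof -
  have fin: "finite H" using H(1) finite_G finite_subset by blast
  have "(\<Sum>P\<in>H. emeasure M P) = (\<Sum>P\<in>H. \<integral>\<^sup>+x. indicator P x \<partial>M)"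
    using H(1) sets_G by (intro sum.cong) auto
  also have "\<dots> = (\<integral>\<^sup>+x. (\<Sum>P\<in>H. indicator P x) \<partial>M)"
    using H(1) sets_G by (intro nn_integral_sum[symmetric]) auto
  also have "\<dots> \<le> (\<integral>\<^sup>+x. ennreal A * indicator T x \<partial>M)"
  proof (rule nn_integral_mono)
    fix x
    show "(\<Sum>P\<in>H. indicator P x) \<le> ennreal A * indicator T x"
    proof (cases "x \<in> T")
      case True
      have "(\<Sum>P\<in>H. indicator P x :: ennreal) = ennreal (\<Sum>P\<in>H. indicator P x)"
        by (simp add: sum_ennreal[symmetric] ennreal_indicator)
      also have "\<dots> \<le> ennreal (\<Sum>P\<in>G. indicator P x)"
        using H(1) finite_G by (intro ennreal_leI sum_mono2) auto
      also have "\<dots> \<le> ennreal A" by (intro ennreal_leI overlap)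
      finally show ?thesis using True by simp
    next
      case False
      then have "(\<Sum>P\<in>H. indicator P x :: ennreal) = 0"
        using H(2) by (intro sum.neutral) (auto split: split_indicator)
      then show ?thesis by simp
    qed
  qed
  also have "\<dots> = ennreal A * emeasure M T" by (simp add: nn_integral_cmult_indicator)
  finally show ?thesis .
qed

text \<open>Greedy Vitali selection: a largest dilated set absorbs all sets of \<open>H\<close> whose dilates it meets.\<close>

lemma weak_type:
  assumes "H \<subseteq> G" and g: "g \<in> borel_measurable M"
    and "\<And>P. P \<in> H \<Longrightarrow> t * emeasure M (\<beta> P) \<le> (\<integral>\<^sup>+x. g x * indicator (\<beta> P) x \<partial>M)"
  shows "t * (\<Sum>P\<in>H. emeasure M P) \<le> ennreal (A * D) * (\<integral>\<^sup>+x. g x * indicator (\<Union>(\<beta> ` H)) x \<partial>M)"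
  using assms(1,3)
proof (induction "card H" arbitrary: H rule: less_induct)
  case less
  note [measurable] = g
  have fin: "finite H" using less.prems(1) finite_G finite_subset by blast
  show ?case
  proof (cases "H = {}")
    case False
    define L where "L = Max (radius ` H)"
    have "L \<in> radius ` H" unfolding L_def using fin False by (intro Max_in) auto
    then obtain P0 where P0: "P0 \<in> H" "radius P0 = L" by auto
    have max: "radius P \<le> radius P0" if "P \<in> H" for P
      unfolding P0(2) L_def using fin that by auto
    define H1 where "H1 = {P\<in>H. \<beta> P \<inter> \<beta> P0 \<noteq> {}}"
    define H2 where "H2 = {P\<in>H. \<beta> P \<inter> \<beta> P0 = {}}"
    have P0G: "P0 \<in> G" using P0 less.prems by auto
    have m2[measurable]: "\<Union>(\<beta> ` H2) \<in> sets M" and m[measurable]: "\<Union>(\<beta> ` H) \<in> sets M"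
      using fin less.prems(1) sets_\<beta> by (auto intro!: sets.finite_Union simp: H2_def)
    note [measurable] = sets_\<beta>[OF P0G] sets_\<gamma>[OF P0G]
    have "P0 \<notin> H2" using measure_pos[OF P0G] subset_\<beta>[OF P0G] by (auto simp: H2_def)
    then have "H2 \<subset> H" using P0 by (auto simp: H2_def)
    then have IH: "t * (\<Sum>P\<in>H2. emeasure M P) \<le> ennreal (A * D) * (\<integral>\<^sup>+x. g x * indicator (\<Union>(\<beta> ` H2)) x \<partial>M)"
      using less.prems fin by (intro less.hyps psubset_card_mono) auto
    \<comment> \<open>\<open>P0\<close> has the largest radius, so every set of \<open>H1\<close>
      lies in \<open>\<gamma> P0\<close>; overlap and doubling charge all of them to
      \<open>P0\<close>.\<close>
    have "(\<Sum>P\<in>H1. emeasure M P) \<le> ennreal A * emeasure M (\<gamma> P0)"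
      using less.prems(1) P0G max by (intro sum_emeasure_le engulf) (auto simp: H1_def)
    also have "\<dots> \<le> ennreal A * (ennreal D * emeasure M P0)"
      by (intro mult_left_mono emeasure_doubling P0G) simp
    also have "\<dots> \<le> ennreal A * (ennreal D * emeasure M (\<beta> P0))"
      by (intro mult_left_mono emeasure_mono subset_\<beta> P0G) auto
    finally have "t * (\<Sum>P\<in>H1. emeasure M P) \<le> t * (ennreal A * (ennreal D * emeasure M (\<beta> P0)))"
      by (intro mult_left_mono) auto
    also have "\<dots> = ennreal (A * D) * (t * emeasure M (\<beta> P0))"
      using A_pos D_pos by (simp add: ennreal_mult mult_ac)
    also have "\<dots> \<le> ennreal (A * D) * (\<integral>\<^sup>+x. g x * indicator (\<beta> P0) x \<partial>M)"
      by (intro mult_left_mono less.prems P0) simp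
    finally have 1: "t * (\<Sum>P\<in>H1. emeasure M P) \<le> ennreal (A * D) * (\<integral>\<^sup>+x. g x * indicator (\<beta> P0) x \<partial>M)" .
    have "H = H1 \<union> H2" "H1 \<inter> H2 = {}" by (auto simp: H1_def H2_def)
    then have "(\<Sum>P\<in>H. emeasure M P) = (\<Sum>P\<in>H1. emeasure M P) + (\<Sum>P\<in>H2. emeasure M P)"
      using fin by (metis finite_Un sum.union_disjoint)
    then have "t * (\<Sum>P\<in>H. emeasure M P)
        \<le> ennreal (A * D) * (\<integral>\<^sup>+x. g x * indicator (\<beta> P0) x \<partial>M)
          + ennreal (A * D) * (\<integral>\<^sup>+x. g x * indicator (\<Union>(\<beta> ` H2)) x \<partial>M)"
      using 1 IH by (simp add: distrib_left add_mono)
    also have "\<dots> = ennreal (A * D) * (\<integral>\<^sup>+x. g x * indicator (\<beta> P0) x + g x * indicator (\<Union>(\<beta> ` H2)) x \<partial>M)"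
      by (simp add: distrib_left nn_integral_add)
    also have "\<dots> \<le> ennreal (A * D) * (\<integral>\<^sup>+x. g x * indicator (\<Union>(\<beta> ` H)) x \<partial>M)"
    proof (intro mult_left_mono nn_integral_mono)
      fix x
      \<comment> \<open>Dilates from \<open>H2\<close> miss \<open>\<beta> P0\<close>, so the two
        integrals live on disjoint sets and the constant does not grow along the recursion.\<close>
      consider "x \<in> \<beta> P0" "x \<notin> \<Union>(\<beta> ` H2)" | "x \<notin> \<beta> P0" by (auto simp: H2_def)
      then show "g x * indicator (\<beta> P0) x + g x * indicator (\<Union>(\<beta> ` H2)) x \<le> g x * indicator (\<Union>(\<beta> ` H)) x"
        using P0(1) by cases (auto simp: H2_def split: split_indicator)
    qed simp
    finally show ?thesis .
  qed simp
qed

text \<open>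
  With \<open>b P\<close> the mean of \<open>g\<close> over \<open>\<beta> P\<close>, the weak type bound is applied, at level \<open>t\<close>, to the part of
  \<open>g\<close> above \<open>t / 2\<close>.
\<close>

lemma carleson_ennreal:
  fixes g b
  assumes g[measurable]: "g \<in> borel_measurable M" and g0: "\<And>x. 0 \<le> g x"
    and b0: "\<And>P. P \<in> G \<Longrightarrow> 0 \<le> b P"
    and b: "\<And>P. P \<in> G \<Longrightarrow> ennreal (b P) * emeasure M (\<beta> P) = (\<integral>\<^sup>+x. ennreal (g x) * indicator (\<beta> P) x \<partial>M)"
  shows "(\<Sum>P\<in>G. emeasure M P * ennreal ((b P)\<^sup>2)) \<le> ennreal (8 * (A * D)) * (\<integral>\<^sup>+x. ennreal ((g x)\<^sup>2) \<partial>M)"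
proof -
  interpret P: pair_sigma_finite M "lborel :: real measure"
    by unfold_locales
  define gt where "gt t x = ennreal (g x) * indicator {x. t \<le> 2 * g x} x" for t x
  have gtm[measurable]: "(\<lambda>(x,t). gt t x) \<in> borel_measurable (M \<Otimes>\<^sub>M lborel)"
  proof -
    have "(\<lambda>(x,t). gt t x) = (\<lambda>w. if snd w \<le> 2 * g (fst w) then ennreal (g (fst w)) else 0)"
      by (auto simp: gt_def fun_eq_iff)
    also have "\<dots> \<in> borel_measurable (M \<Otimes>\<^sub>M lborel)" by measurable
    finally show ?thesis .
  qed
  have gtm'[measurable]: "gt t \<in> borel_measurable M" for t
    unfolding gt_def by measurable
  have level: "ennreal (2 * t) * (\<Sum>P\<in>{P\<in>G. t \<le> b P}. emeasure M P)
      \<le> ennreal (4 * (A * D)) * (\<integral>\<^sup>+x. gt t x \<partial>M)" if t: "0 \<le> t" for t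
  proof -
    let ?H = "{P\<in>G. t \<le> b P}"
    \<comment> \<open>The integral of \<open>g\<close> over \<open>\<beta> P\<close> is at least
      \<open>t * emeasure M (\<beta> P)\<close>. The part of \<open>g\<close> below
      \<open>t / 2\<close> supplies at most half of this; the rest comes from
      \<open>gt t\<close>.\<close>
    have w: "ennreal (t / 2) * emeasure M (\<beta> P) \<le> (\<integral>\<^sup>+x. gt t x * indicator (\<beta> P) x \<partial>M)" if P: "P \<in> ?H" for P
    proof -
      have PG: "P \<in> G" using P by simp
      note [measurable] = sets_\<beta>[OF PG]
      have "ennreal (t / 2) * emeasure M (\<beta> P) + ennreal (t / 2) * emeasure M (\<beta> P)
          = ennreal t * emeasure M (\<beta> P)"
        using t by (simp add: distrib_right[symmetric] ennreal_plus[symmetric] del: ennreal_plus)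
      also have "\<dots> \<le> ennreal (b P) * emeasure M (\<beta> P)"
        using P by (intro mult_right_mono ennreal_leI) auto
      also have "\<dots> = (\<integral>\<^sup>+x. ennreal (g x) * indicator (\<beta> P) x \<partial>M)" by (rule b[OF PG])
      also have "\<dots> \<le> (\<integral>\<^sup>+x. ennreal (t / 2) * indicator (\<beta> P) x + gt t x * indicator (\<beta> P) x \<partial>M)"
        by (intro nn_integral_mono) (auto simp: gt_def intro!: ennreal_leI split: split_indicator)
      also have "\<dots> = ennreal (t / 2) * emeasure M (\<beta> P) + (\<integral>\<^sup>+x. gt t x * indicator (\<beta> P) x \<partial>M)"
        by (simp add: nn_integral_add nn_integral_cmult_indicator)
      finally show ?thesis
        by (subst (asm) ennreal_add_left_cancel_le) (auto simp: emeasure_eq_measure ennreal_mult_eq_top_iff)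
    qed
    have "ennreal (2 * t) * (\<Sum>P\<in>?H. emeasure M P) = ennreal 4 * (ennreal (t / 2) * (\<Sum>P\<in>?H. emeasure M P))"
      using t by (simp only: mult.assoc[symmetric] ennreal_mult[symmetric]) simp
    also have "\<dots> \<le> ennreal 4 * (ennreal (A * D) * (\<integral>\<^sup>+x. gt t x * indicator (\<Union>(\<beta> ` ?H)) x \<partial>M))"
      by (intro mult_left_mono weak_type w) auto
    also have "\<dots> \<le> ennreal 4 * (ennreal (A * D) * (\<integral>\<^sup>+x. gt t x \<partial>M))"
      by (intro mult_left_mono nn_integral_mono) (auto split: split_indicator)
    finally show ?thesis using A_pos D_pos by (simp add: ennreal_mult mult.assoc)
  qed
  have "(\<Sum>P\<in>G. emeasure M P * ennreal ((b P)\<^sup>2))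
      = (\<Sum>P\<in>G. \<integral>\<^sup>+t. emeasure M P * (ennreal (2 * t) * indicator {0..b P} t) \<partial>lborel)"
    by (intro sum.cong refl) (simp add: nn_integral_cmult nn_integral_layer b0)
  also have "\<dots> = (\<integral>\<^sup>+t. (\<Sum>P\<in>G. emeasure M P * (ennreal (2 * t) * indicator {0..b P} t)) \<partial>lborel)"
    by (intro nn_integral_sum[symmetric]) auto
  also have "\<dots> \<le> (\<integral>\<^sup>+t. ennreal (4 * (A * D)) * ((\<integral>\<^sup>+x. gt t x \<partial>M) * indicator {0..} t) \<partial>lborel)"
  proof (rule nn_integral_mono)
    fix t :: real
    show "(\<Sum>P\<in>G. emeasure M P * (ennreal (2 * t) * indicator {0..b P} t))
        \<le> ennreal (4 * (A * D)) * ((\<integral>\<^sup>+x. gt t x \<partial>M) * indicator {0..} t)"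
    proof (cases "0 \<le> t")
      case True
      have "(\<Sum>P\<in>G. emeasure M P * (ennreal (2 * t) * indicator {0..b P} t))
          = (\<Sum>P\<in>{P\<in>G. t \<le> b P}. ennreal (2 * t) * emeasure M P)"
        using True finite_G by (intro sum.mono_neutral_cong_right) (auto simp: mult.commute)
      then show ?thesis using level[OF True] True by (simp add: sum_distrib_left)
    qed (auto simp: indicator_def)
  qed
  also have "\<dots> = ennreal (4 * (A * D)) * (\<integral>\<^sup>+t. (\<integral>\<^sup>+x. gt t x * indicator {0..} t \<partial>M) \<partial>lborel)"
    by (simp add: nn_integral_cmult nn_integral_multc)
  also have "(\<integral>\<^sup>+t. (\<integral>\<^sup>+x. gt t x * indicator {0..} t \<partial>M) \<partial>lborel)
      = (\<integral>\<^sup>+x. (\<integral>\<^sup>+t. gt t x * indicator {0..} t \<partial>lborel) \<partial>M)"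
    by (rule P.Fubini') measurable
  \<comment> \<open>The inner integral equals \<open>2 * (g x)\<^sup>2\<close>, which turns the
    factor 4 of the level estimate into 8.\<close>
  also have "\<dots> = (\<integral>\<^sup>+x. (\<integral>\<^sup>+t. ennreal (g x) * indicator {0..2 * g x} t \<partial>lborel) \<partial>M)"
    by (intro nn_integral_cong) (auto simp: gt_def split: split_indicator)
  also have "\<dots> = (\<integral>\<^sup>+x. ennreal 2 * ennreal ((g x)\<^sup>2) \<partial>M)"
    using g0 by (intro nn_integral_cong) (simp add: nn_integral_cmult_indicator ennreal_mult[symmetric] power2_eq_square del: ennreal_numeral)
  also have "\<dots> = ennreal 2 * (\<integral>\<^sup>+x. ennreal ((g x)\<^sup>2) \<partial>M)"
    by (rule nn_integral_cmult) measurable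
  finally show ?thesis using A_pos D_pos
    by (simp add: mult.assoc[symmetric] ennreal_mult[symmetric] del: ennreal_numeral)
qed

text \<open>
  No duality with maximal functions is needed: the Carleson embedding is applied to the sum \<open>g\<close> itself,
  and the resulting multiple of its squared norm is absorbed on the left.
\<close>

lemma dilated_sum_L2:
  assumes a: "\<And>P. P \<in> G \<Longrightarrow> 0 \<le> a P"
  defines "g \<equiv> \<lambda>x. \<Sum>P\<in>G. a P * indicator (\<beta> P) x"
  shows "integrable M (\<lambda>x. (g x)\<^sup>2)"
    and "(\<integral>x. (g x)\<^sup>2 \<partial>M) \<le> 8 * A * D ^ 3 * (\<Sum>P\<in>G. (a P)\<^sup>2 * measure M P)"
proof -
  have gm[measurable]: "g \<in> borel_measurable M"
    unfolding g_def by measurable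
  have g0: "0 \<le> g x" for x unfolding g_def using a by (intro sum_nonneg) auto
  \<comment> \<open>This bound rests on the finiteness of \<open>G\<close>. It makes the squared
    norm of \<open>g\<close> finite, so that a fraction of it can be absorbed.\<close>
  have gB: "g x \<le> (\<Sum>P\<in>G. a P)" for x
    unfolding g_def using a by (intro sum_mono) (auto split: split_indicator)
  have int: "integrable M (\<lambda>x. h x * g x)" if h: "h \<in> borel_measurable M" "\<And>x. 0 \<le> h x" "\<And>x. h x \<le> B" for h B
  proof (rule integrable_const_bound)
    show "AE x in M. norm (h x * g x) \<le> B * (\<Sum>P\<in>G. a P)"
      using h g0 gB by (intro AE_I2) (auto simp: abs_mult intro!: mult_mono order_trans[OF h(2) h(3)])
  qed (use h in auto)
  show int2: "integrable M (\<lambda>x. (g x)\<^sup>2)"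
    unfolding power2_eq_square by (rule int[OF gm g0 gB])
  have inti: "integrable M (\<lambda>x. indicator (\<beta> P) x * g x)" if "P \<in> G" for P
    using sets_\<beta>[OF that] by (intro int[of _ 1]) (auto split: split_indicator)
  define b where "b P = (\<integral>x. indicator (\<beta> P) x * g x \<partial>M) / measure M (\<beta> P)" for P
  have b0: "0 \<le> b P" for P
    unfolding b_def using g0 by (intro divide_nonneg_nonneg Bochner_Integration.integral_nonneg) (auto split: split_indicator)
  have \<beta>pos: "0 < measure M (\<beta> P)" if "P \<in> G" for P
    using measure_pos[OF that] finite_measure_mono[OF subset_\<beta>[OF that] sets_\<beta>[OF that]] by linarith
  have b: "b P * measure M (\<beta> P) = (\<integral>x. indicator (\<beta> P) x * g x \<partial>M)" if "P \<in> G" for P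
    using \<beta>pos[OF that] by (simp add: b_def)
  define I where "I = (\<integral>x. (g x)\<^sup>2 \<partial>M)"
  define S where "S = (\<Sum>P\<in>G. (a P)\<^sup>2 * measure M P)"
  have "(\<Sum>P\<in>G. emeasure M P * ennreal ((b P)\<^sup>2)) \<le> ennreal (8 * (A * D)) * (\<integral>\<^sup>+x. ennreal ((g x)\<^sup>2) \<partial>M)"
  proof (rule carleson_ennreal[OF gm g0 b0])
    fix P assume P: "P \<in> G"
    have "ennreal (b P) * emeasure M (\<beta> P) = ennreal (\<integral>x. indicator (\<beta> P) x * g x \<partial>M)"
      using b0 b[OF P] by (simp add: emeasure_eq_measure ennreal_mult[symmetric])
    also have "\<dots> = (\<integral>\<^sup>+x. ennreal (indicator (\<beta> P) x * g x) \<partial>M)"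
      using g0 inti[OF P] by (intro nn_integral_eq_integral[symmetric]) auto
    also have "\<dots> = (\<integral>\<^sup>+x. ennreal (g x) * indicator (\<beta> P) x \<partial>M)"
      by (intro nn_integral_cong) (auto split: split_indicator)
    finally show "ennreal (b P) * emeasure M (\<beta> P) = (\<integral>\<^sup>+x. ennreal (g x) * indicator (\<beta> P) x \<partial>M)" .
  qed
  also have "(\<integral>\<^sup>+x. ennreal ((g x)\<^sup>2) \<partial>M) = ennreal I"
    unfolding I_def using int2 by (intro nn_integral_eq_integral) auto
  also have "(\<Sum>P\<in>G. emeasure M P * ennreal ((b P)\<^sup>2)) = ennreal (\<Sum>P\<in>G. measure M P * (b P)\<^sup>2)"
    by (simp add: emeasure_eq_measure ennreal_mult[symmetric] sum_ennreal)
  also have "ennreal (8 * (A * D)) * ennreal I = ennreal (8 * (A * D) * I)"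
    using A_pos D_pos by (simp add: ennreal_mult' )
  finally have strong: "(\<Sum>P\<in>G. measure M P * (b P)\<^sup>2) \<le> 8 * (A * D) * I"
    using A_pos D_pos by (subst (asm) ennreal_le_iff) (auto simp: I_def)
  have "I = (\<integral>x. (\<Sum>P\<in>G. a P * (indicator (\<beta> P) x * g x)) \<partial>M)"
    unfolding I_def power2_eq_square
    by (intro Bochner_Integration.integral_cong refl)
       (simp add: g_def sum_distrib_right mult.assoc)
  also have "\<dots> = (\<Sum>P\<in>G. a P * (b P * measure M (\<beta> P)))"
    using inti b by (simp add: Bochner_Integration.integral_sum)
  \<comment> \<open>Young's inequality, weighted so that the Carleson bound with constant
    \<open>8 * (A * D)\<close> turns the first sum into at most \<open>I / 2\<close>. The square
    behind it is \<open>(b P - 8 * A * D\<^sup>2 * a P)\<^sup>2\<close>.\<close>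
  also have "\<dots> \<le> (\<Sum>P\<in>G. measure M P * (b P)\<^sup>2 / (16 * (A * D)) + 4 * A * D ^ 3 * ((a P)\<^sup>2 * measure M P))"
  proof (rule sum_mono)
    fix P assume P: "P \<in> G"
    have "measure M (\<beta> P) \<le> D * measure M P"
      using doubling[OF P] finite_measure_mono[OF \<beta>_subset_\<gamma>[OF P] sets_\<gamma>[OF P]] by linarith
    then have "a P * (b P * measure M (\<beta> P)) \<le> a P * (b P * (D * measure M P))"
      by (intro mult_left_mono a b0 P)
    also have "\<dots> = measure M P * (D * a P * b P)" by simp
    also have "\<dots> \<le> measure M P * ((b P)\<^sup>2 / (16 * (A * D)) + 4 * A * D ^ 3 * (a P)\<^sup>2)"
    proof (intro mult_left_mono)
      have "0 \<le> (b P - 8 * A * D\<^sup>2 * a P)\<^sup>2 / (16 * (A * D))"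
        using A_pos D_pos by (intro divide_nonneg_pos) auto
      also have "\<dots> = (b P)\<^sup>2 / (16 * (A * D)) + 4 * A * D ^ 3 * (a P)\<^sup>2 - D * a P * b P"
        using A_pos D_pos by (simp add: field_simps power2_eq_square power3_eq_cube)
      finally show "D * a P * b P \<le> (b P)\<^sup>2 / (16 * (A * D)) + 4 * A * D ^ 3 * (a P)\<^sup>2" by simp
    qed simp
    finally show "a P * (b P * measure M (\<beta> P))
        \<le> measure M P * (b P)\<^sup>2 / (16 * (A * D)) + 4 * A * D ^ 3 * ((a P)\<^sup>2 * measure M P)"
      by (simp add: algebra_simps)
  qed
  also have "\<dots> = (\<Sum>P\<in>G. measure M P * (b P)\<^sup>2) / (16 * (A * D)) + 4 * A * D ^ 3 * S"
    by (simp add: sum.distrib sum_divide_distrib sum_distrib_left S_def)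
  also have "\<dots> \<le> 8 * (A * D) * I / (16 * (A * D)) + 4 * A * D ^ 3 * S"
    using strong A_pos D_pos by (intro add_right_mono divide_right_mono) auto
  also have "\<dots> = I / 2 + 4 * A * D ^ 3 * S" using A_pos D_pos by simp
  finally show "(\<integral>x. (g x)\<^sup>2 \<partial>M) \<le> 8 * A * D ^ 3 * (\<Sum>P\<in>G. (a P)\<^sup>2 * measure M P)"
    unfolding I_def S_def by simp
qed

text \<open>\<open>c P\<close> is a local constant approximating \<open>v\<close> on
  \<open>P\<close>. Consecutive sets of a chain overlap in a fixed share of their measure, so their
  constants are close; along a chain ending at \<open>Q\<close> the differences telescope, and on
  \<open>Q\<close> their total is dominated by a sum over dilates. In the constant, 2 pays for the
  deviation on \<open>Q\<close> itself, and 128 is 16 from squaring the jump times 8 from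
  \<open>dilated_sum_L2\<close>.\<close>

lemma chain_gluing:
  fixes v :: "'a \<Rightarrow> real" and c :: "'a set \<Rightarrow> real"
  assumes v: "integrable M v" "integrable M (\<lambda>x. (v x)\<^sup>2)"
    and H: "H \<subseteq> G" and C: "0 < C"
    and chains: "\<And>Q. Q \<in> H \<Longrightarrow> \<exists>(N::nat) P. P 0 = Q0 \<and> P N = Q \<and> (\<forall>j\<le>N. P j \<in> G) \<and> inj_on P {..N}
        \<and> (\<forall>j<N. Q \<subseteq> \<beta> (P j))
        \<and> (\<forall>j<N. measure M (P j \<inter> P (Suc j)) \<ge> inverse C * max (measure M (P j)) (measure M (P (Suc j))))"
  shows "(\<integral>x. indicator (\<Union>H) x * (v x - c Q0)\<^sup>2 \<partial>M)
    \<le> (2 + 128 * C * A\<^sup>2 * D ^ 3) * (\<Sum>P\<in>G. \<integral>x. indicator P x * (v x - c P)\<^sup>2 \<partial>M)"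
proof -
  have finH: "finite H" using H finite_G finite_subset by blast
  have sq: "integrable M (\<lambda>x. (v x - k)\<^sup>2)" for k
    using v by (simp add: power2_diff)
  have sqi: "integrable M (\<lambda>x. indicator S x * (v x - k)\<^sup>2)" if "S \<in> sets M" for S k
    using integrable_mult_indicator[OF that sq[of k]] by simp
  define J where "J P = (\<integral>x. indicator P x * (v x - c P)\<^sup>2 \<partial>M)" for P
  have J0: "0 \<le> J P" for P unfolding J_def by (intro Bochner_Integration.integral_nonneg) auto
  \<comment> \<open>The root mean square deviation of \<open>v\<close> from \<open>c P\<close> on
    \<open>P\<close>.\<close>
  define a where "a P = sqrt (J P / measure M P)" for P
  have a0: "0 \<le> a P" for P using J0 by (simp add: a_def)
  have a2: "(a P)\<^sup>2 * measure M P = J P" if "P \<in> G" for P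
    using J0[of P] measure_pos[OF that] by (simp add: a_def)
  define g where "g x = (\<Sum>P\<in>G. a P * indicator (\<beta> P) x)" for x
  have g: "integrable M (\<lambda>x. (g x)\<^sup>2)" "(\<integral>x. (g x)\<^sup>2 \<partial>M) \<le> 8 * A * D ^ 3 * (\<Sum>P\<in>G. J P)"
    using dilated_sum_L2[of a] a0 a2 by (auto simp: g_def cong: sum.cong)
  \<comment> \<open>On the overlap both constants are compared with \<open>v\<close>; the overlap
    hypothesis bounds by \<open>C\<close> the loss in averaging over the overlap alone.\<close>
  have step: "\<bar>c P' - c P\<bar> \<le> sqrt (2 * C) * (a P + a P')"
    if PP: "P \<in> G" "P' \<in> G" and ov: "inverse C * max (measure M P) (measure M P') \<le> measure M (P \<inter> P')" for P P'
  proof -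
    define m where "m = max (measure M P) (measure M P')"
    have m: "0 < m" "measure M P \<le> m" "measure M P' \<le> m"
      using measure_pos[OF PP(1)] by (auto simp: m_def)
    have [measurable]: "P \<in> sets M" "P' \<in> sets M" using PP sets_G by auto
    have "(c P' - c P)\<^sup>2 * measure M (P \<inter> P') = (\<integral>x. indicator (P \<inter> P') x * (c P' - c P)\<^sup>2 \<partial>M)"
      by simp
    also have "\<dots> \<le> (\<integral>x. 2 * (indicator P x * (v x - c P)\<^sup>2) + 2 * (indicator P' x * (v x - c P')\<^sup>2) \<partial>M)"
    proof (intro integral_mono)
      fix x
      have "(c P' - c P)\<^sup>2 \<le> 2 * (v x - c P)\<^sup>2 + 2 * (v x - c P')\<^sup>2"
        using square_sum_le[of "v x - c P" "c P' - v x"] by (simp add: power2_commute)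
      then show "indicator (P \<inter> P') x * (c P' - c P)\<^sup>2
          \<le> 2 * (indicator P x * (v x - c P)\<^sup>2) + 2 * (indicator P' x * (v x - c P')\<^sup>2)"
        by (auto split: split_indicator)
    next
      show "integrable M (\<lambda>x. indicator (P \<inter> P') x * (c P' - c P)\<^sup>2)"
        by (intro integrable_mult_left integrable_real_indicator) (auto simp: emeasure_eq_measure)
      show "integrable M (\<lambda>x. 2 * (indicator P x * (v x - c P)\<^sup>2) + 2 * (indicator P' x * (v x - c P')\<^sup>2))"
        by (intro Bochner_Integration.integrable_add integrable_mult_right sqi) auto
    qed
    also have "\<dots> = 2 * J P + 2 * J P'"
      unfolding J_def by (simp add: sqi)
    also have "\<dots> = 2 * ((a P)\<^sup>2 * measure M P) + 2 * ((a P')\<^sup>2 * measure M P')"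
      using PP by (simp add: a2)
    also have "\<dots> \<le> 2 * ((a P)\<^sup>2 * m) + 2 * ((a P')\<^sup>2 * m)"
      using m by (intro add_mono mult_left_mono) auto
    finally have "(c P' - c P)\<^sup>2 * measure M (P \<inter> P') \<le> 2 * ((a P)\<^sup>2 + (a P')\<^sup>2) * m"
      by (simp add: algebra_simps)
    moreover have "(c P' - c P)\<^sup>2 * (inverse C * m) \<le> (c P' - c P)\<^sup>2 * measure M (P \<inter> P')"
      using ov by (intro mult_left_mono) (auto simp: m_def)
    ultimately have "(c P' - c P)\<^sup>2 * inverse C * m \<le> 2 * ((a P)\<^sup>2 + (a P')\<^sup>2) * m"
      by (simp add: mult.assoc)
    then have "(c P' - c P)\<^sup>2 * inverse C \<le> 2 * ((a P)\<^sup>2 + (a P')\<^sup>2)" using m(1) by simp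
    then have "(c P' - c P)\<^sup>2 \<le> 2 * C * ((a P)\<^sup>2 + (a P')\<^sup>2)" using C by (simp add: field_simps)
    also have "\<dots> \<le> 2 * C * (a P + a P')\<^sup>2"
      using C a0[of P] a0[of P'] by (intro mult_left_mono) (auto simp: power2_sum)
    finally have "sqrt ((c P' - c P)\<^sup>2) \<le> sqrt (2 * C * (a P + a P')\<^sup>2)" by (rule real_sqrt_le_mono)
    then show ?thesis using a0[of P] a0[of P'] by (simp add: real_sqrt_mult)
  qed
  have jump: "(c Q - c Q0)\<^sup>2 \<le> 8 * C * (g x)\<^sup>2" if Q: "Q \<in> H" and x: "x \<in> Q" for Q x
  proof -
    obtain N :: nat and P where P: "P 0 = Q0" "P N = Q" "\<And>j. j \<le> N \<Longrightarrow> P j \<in> G" "inj_on P {..N}"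
      "\<And>j. j < N \<Longrightarrow> Q \<subseteq> \<beta> (P j)"
      "\<And>j. j < N \<Longrightarrow> inverse C * max (measure M (P j)) (measure M (P (Suc j))) \<le> measure M (P j \<inter> P (Suc j))"
      using chains[OF Q] by blast
    \<comment> \<open>The chain hypothesis covers the indices below \<open>N\<close>; at
      \<open>N\<close> itself, \<open>Q\<close> lies in its own dilate.\<close>
    have in\<beta>: "x \<in> \<beta> (P j)" if "j \<le> N" for j
    proof (cases "j = N")
      case True
      then show ?thesis using P(2) x subset_\<beta>[of Q] Q H by auto
    next
      case False
      then show ?thesis using P(5)[of j] x that by auto
    qed
    have "\<bar>c (P N) - c (P 0)\<bar> \<le> 2 * sqrt (2 * C) * (\<Sum>j\<le>N. a (P j))"
      using C a0 by (intro telescope_abs_le step P) auto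
    \<comment> \<open>Distinctness of the chain: each set occurs once, as in the sum defining
      \<open>g\<close>.\<close>
    also have "(\<Sum>j\<le>N. a (P j)) = (\<Sum>P'\<in>P ` {..N}. a P')"
      using P(4) by (simp add: sum.reindex)
    also have "\<dots> = (\<Sum>P'\<in>P ` {..N}. a P' * indicator (\<beta> P') x)"
      using in\<beta> by (intro sum.cong) auto
    also have "\<dots> \<le> g x"
      unfolding g_def using a0 P(3) finite_G by (intro sum_mono2) auto
    finally have "\<bar>c Q - c Q0\<bar> \<le> 2 * sqrt (2 * C) * g x"
      using C P(1,2) by (simp add: mult_left_mono)
    then have "\<bar>c Q - c Q0\<bar>\<^sup>2 \<le> (2 * sqrt (2 * C) * g x)\<^sup>2" by (rule power_mono) simp
    then show ?thesis using C by (simp add: power_mult_distrib)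
  qed
  have UH: "\<Union>H \<in> sets M" using finH H sets_G by (intro sets.finite_Union) auto
  have "(\<integral>x. indicator (\<Union>H) x * (v x - c Q0)\<^sup>2 \<partial>M)
      \<le> (\<integral>x. (\<Sum>Q\<in>H. 2 * (indicator Q x * (v x - c Q)\<^sup>2)) + 16 * C * A * (g x)\<^sup>2 \<partial>M)"
  proof (intro integral_mono)
    fix x
    show "indicator (\<Union>H) x * (v x - c Q0)\<^sup>2
        \<le> (\<Sum>Q\<in>H. 2 * (indicator Q x * (v x - c Q)\<^sup>2)) + 16 * C * A * (g x)\<^sup>2"
    proof (cases "x \<in> \<Union>H")
      case True
      then obtain Q where Q: "Q \<in> H" "x \<in> Q" by blast
      \<comment> \<open>A point in a set of the family has overlap at least 1; this lets the factor
        \<open>A\<close> be inserted in the bound.\<close>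
      have "1 \<le> A"
      proof -
        have "1 = (\<Sum>P\<in>{Q}. indicator P x :: real)" using Q by simp
        also have "\<dots> \<le> (\<Sum>P\<in>G. indicator P x)"
          using Q H finite_G by (intro sum_mono2) auto
        finally show ?thesis using overlap[of x] by linarith
      qed
      have "(v x - c Q0)\<^sup>2 \<le> 2 * (v x - c Q)\<^sup>2 + 2 * (c Q - c Q0)\<^sup>2"
        using square_sum_le[of "v x - c Q" "c Q - c Q0"] by simp
      also have "2 * (v x - c Q)\<^sup>2 = (\<Sum>Q\<in>{Q}. 2 * (indicator Q x * (v x - c Q)\<^sup>2))"
        using Q by simp
      also have "\<dots> \<le> (\<Sum>Q\<in>H. 2 * (indicator Q x * (v x - c Q)\<^sup>2))"
        using Q finH by (intro sum_mono2) auto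
      also have "2 * (c Q - c Q0)\<^sup>2 \<le> 16 * C * (g x)\<^sup>2" using jump[OF Q] by simp
      also have "\<dots> \<le> 16 * C * A * (g x)\<^sup>2"
        using \<open>1 \<le> A\<close> C by (intro mult_right_mono) auto
      finally show ?thesis using True by simp
    next
      case False
      have "0 \<le> (\<Sum>Q\<in>H. 2 * (indicator Q x * (v x - c Q)\<^sup>2)) + 16 * C * A * (g x)\<^sup>2"
        using C A_pos by (intro add_nonneg_nonneg sum_nonneg) auto
      then show ?thesis using False by simp
    qed
  next
    show "integrable M (\<lambda>x. (\<Sum>Q\<in>H. 2 * (indicator Q x * (v x - c Q)\<^sup>2)) + 16 * C * A * (g x)\<^sup>2)"
      using g(1) H sets_G
      by (intro Bochner_Integration.integrable_add Bochner_Integration.integrable_sum integrable_mult_right sqi) auto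
  qed (rule sqi[OF UH])
  also have "\<dots> = (\<Sum>Q\<in>H. 2 * J Q) + 16 * C * A * (\<integral>x. (g x)\<^sup>2 \<partial>M)"
    using g(1) H sets_G sqi unfolding J_def
    by (subst Bochner_Integration.integral_add)
       (auto simp: Bochner_Integration.integral_sum subset_iff intro!: Bochner_Integration.integrable_sum)
  also have "\<dots> \<le> 2 * (\<Sum>P\<in>G. J P) + 16 * C * A * (8 * A * D ^ 3 * (\<Sum>P\<in>G. J P))"
    using H finite_G J0 g(2) C A_pos
    by (intro add_mono mult_left_mono) (auto simp: sum_distrib_left[symmetric] intro!: sum_mono2)
  also have "\<dots> = (2 + 128 * C * A\<^sup>2 * D ^ 3) * (\<Sum>P\<in>G. J P)"
    by (simp add: algebra_simps power2_eq_square)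
  finally show ?thesis unfolding J_def .
qed

end

section \<open>Cubes and density bounds\<close>

lemma open_cube_cases:
  assumes "is_open_cube Q"
  obtains c s U where "0 < s" "orthogonal_transformation U" "Q = open_cube c s U"
  using assms unfolding is_open_cube_def is_cube_centred_def by blast

lemma open_cube_mono:
  fixes c :: "'a::euclidean_space"
  shows "s \<le> t \<Longrightarrow> open_cube c s U \<subseteq> open_cube c t U"
  unfolding open_cube_def
proof (intro image_mono subsetI, unfold box_symmetric_iff, rule ballI)
  fix x b :: 'a assume "s \<le> t" "\<forall>b\<in>Basis. \<bar>x \<bullet> b\<bar> < s / 2" "b \<in> Basis"
  then have "\<bar>x \<bullet> b\<bar> < s / 2" "s \<le> t" by blast+
  then show "\<bar>x \<bullet> b\<bar> < t / 2" by linarith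
qed

lemma open_open_cube: "orthogonal_transformation U \<Longrightarrow> open (open_cube c s U)"
proof -
  assume U: "orthogonal_transformation U"
  have "open (U ` box (- (s / 2) *\<^sub>R One) ((s / 2) *\<^sub>R One))"
    by (rule open_surjective_linear_image)
       (auto simp: orthogonal_transformation_linear[OF U] orthogonal_transformation_surj[OF U])
  then show ?thesis
    using open_translation[of _ c] by (simp add: open_cube_def image_image[of "(+) c" U, symmetric])
qed

lemma convex_open_cube: "orthogonal_transformation U \<Longrightarrow> convex (open_cube c s U)"
proof -
  assume U: "orthogonal_transformation U"
  have "convex (U ` box (- (s / 2) *\<^sub>R One) ((s / 2) *\<^sub>R One))"
    by (rule convex_linear_image) (auto simp: orthogonal_transformation_linear[OF U])
  then show ?thesis
    using convex_translation[of _ c] by (simp add: open_cube_def image_image[of "(+) c" U, symmetric])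
qed

lemma open_cube_norm_le:
  fixes x c :: "'a::euclidean_space"
  assumes U: "orthogonal_transformation U" and x: "x \<in> open_cube c s U" and s: "0 < s"
  shows "norm (x - c) \<le> s * sqrt (real DIM('a)) / 2"
proof -
  obtain z where z: "\<And>b. b \<in> Basis \<Longrightarrow> \<bar>z \<bullet> b\<bar> < s / 2" "x = c + U z"
    using x unfolding open_cube_def image_iff Bex_def box_symmetric_iff by blast
  have "norm (x - c) = norm z" using z(2) orthogonal_transformation_norm[OF U] by simp
  also have "\<dots> = sqrt (\<Sum>b\<in>Basis. (z \<bullet> b)\<^sup>2)"
    unfolding norm_eq_sqrt_inner by (subst euclidean_inner) (simp add: power2_eq_square)
  also have "\<dots> \<le> sqrt (\<Sum>b\<in>(Basis::'a set). (s / 2)\<^sup>2)"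
    using z(1) s by (intro real_sqrt_le_mono sum_mono) (auto simp: abs_le_square_iff[symmetric] intro: less_imp_le)
  also have "\<dots> = s * sqrt (real DIM('a)) / 2" using s by (simp add: real_sqrt_mult)
  finally show ?thesis .
qed

lemma mem_open_cube_if_close:
  assumes U: "orthogonal_transformation U" and x: "norm (x - c) < s / 2"
  shows "x \<in> open_cube c s U"
proof -
  obtain z where z: "U z = x - c" using orthogonal_transformation_surj[OF U] by (metis surjD)
  have "norm z < s / 2" using x z orthogonal_transformation_norm[OF U, of z] by simp
  then have "z \<in> box (- (s / 2) *\<^sub>R One) ((s / 2) *\<^sub>R One)"
    unfolding box_symmetric_iff
    by (intro ballI) (rule le_less_trans[OF Basis_le_norm])
  moreover have "x = c + U z" using z by simp
  ultimately show ?thesis unfolding open_cube_def by blast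
qed

lemma dilate_subset:
  fixes Q :: "'a::euclidean_space set"
  assumes "is_open_cube Q" "0 < k" "k \<le> l"
  shows "dilate k Q \<subseteq> dilate l Q"
  using assms(1)
proof (rule open_cube_cases)
  fix c :: 'a and s U assume Q: "0 < s" "orthogonal_transformation U" "Q = open_cube c s U"
  have "dilate k Q = open_cube c (k * s) U" "dilate l Q = open_cube c (l * s) U"
    using Q assms(2,3) dilate_open_cube[OF Q(2,1), of k c] dilate_open_cube[OF Q(2,1), of l c] by auto
  then show ?thesis using Q(1) assms(3) by (simp add: open_cube_mono)
qed

lemma subset_dilate:
  assumes "is_open_cube Q" "1 \<le> l"
  shows "Q \<subseteq> dilate l Q"
proof -
  have "dilate 1 Q = Q" unfolding dilate_def by simp
  then show ?thesis using dilate_subset[OF assms(1), of 1 l] assms(2) by simp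
qed

lemma is_open_cube_dilate:
  assumes "is_open_cube Q" "0 < l"
  shows "is_open_cube (dilate l Q)"
  using assms(1)
proof (rule open_cube_cases)
  fix c s U assume Q: "0 < s" "orthogonal_transformation U" "Q = open_cube c s U"
  have "dilate l Q = open_cube c (l * s) U" "0 < l * s"
    using Q assms(2) dilate_open_cube[OF Q(2,1) assms(2), of c] by auto
  with Q(2) show ?thesis unfolding is_open_cube_def is_cube_centred_def by blast
qed

lemma is_open_cube_props:
  assumes "is_open_cube Q"
  shows "open Q" "convex Q" "bounded Q" "Q \<noteq> {}"
proof -
  obtain c s U where Q: "0 < s" "orthogonal_transformation U" "Q = open_cube c s U"
    using assms by (rule open_cube_cases)
  show "open Q" "convex Q" "bounded Q" "Q \<noteq> {}"
    using open_open_cube[OF Q(2)] convex_open_cube[OF Q(2)] bounded_open_cube[OF Q(2)]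
      center_mem_open_cube[OF Q(2,1), of c] Q(3) by auto
qed

lemma emeasure_open_cube:
  assumes "is_open_cube Q"
  shows "emeasure lborel Q \<noteq> 0" "emeasure lborel Q \<noteq> \<infinity>"
proof -
  note Q = is_open_cube_props[OF assms]
  show "emeasure lborel Q \<noteq> 0"
  proof
    assume "emeasure lborel Q = 0"
    then have "Q \<in> null_sets lborel" using Q(1) by auto
    then have "negligible Q" by (simp add: negligible_iff_null_sets null_sets_completionI)
    then show False using open_not_negligible Q(1,4) by blast
  qed
  show "emeasure lborel Q \<noteq> \<infinity>"
    using emeasure_bounded_finite[OF Q(3)] by simp
qed

text \<open>Any side length representing \<open>Q\<close> will do: it ranks the cubes by size in the
  Vitali selection.\<close>

definition cube_side :: "'a::euclidean_space set \<Rightarrow> real" where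
  "cube_side Q = (SOME s. \<exists>c U. 0 < s \<and> orthogonal_transformation U \<and> Q = open_cube c s U)"

lemma cube_side:
  assumes "is_open_cube Q"
  obtains c U where "0 < cube_side Q" "orthogonal_transformation U" "Q = open_cube c (cube_side Q) U"
proof -
  have "\<exists>s c U. 0 < s \<and> orthogonal_transformation U \<and> Q = open_cube c s U"
    using assms by (elim open_cube_cases) blast
  from someI_ex[OF this] show ?thesis unfolding cube_side_def[symmetric] using that by blast
qed

text \<open>Through a common point of the dilates, and with \<open>s'\<close> the side of
  \<open>P'\<close> and \<open>d\<close> the dimension, \<open>p\<close> is within
  \<open>3/2 * B * sqrt d * s'\<close> of the centre of \<open>P'\<close>, less than the inradius
  \<open>5/2 * B * sqrt d * s'\<close> of the large cube. The cubes may be rotated against each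
  other, so circumscribed balls are compared with inscribed ones; their ratio is the source of
  \<open>sqrt d\<close>.\<close>

lemma cube_engulf:
  fixes P P' :: "'a::euclidean_space set"
  assumes P: "is_open_cube P" and P': "is_open_cube P'" and B: "1 \<le> B"
    and meet: "dilate B P \<inter> dilate B P' \<noteq> {}" and le: "cube_side P \<le> cube_side P'"
  shows "P \<subseteq> dilate (5 * B * sqrt (real DIM('a))) P'"
proof
  fix p assume p: "p \<in> P"
  let ?d = "sqrt (real DIM('a))" and ?s = "cube_side P" and ?s' = "cube_side P'"
  obtain c U where c: "0 < ?s" "orthogonal_transformation U" "P = open_cube c ?s U"
    by (rule cube_side[OF P])
  obtain c' U' where c': "0 < ?s'" "orthogonal_transformation U'" "P' = open_cube c' ?s' U'"
    by (rule cube_side[OF P'])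
  have d: "1 \<le> ?d" using DIM_positive[where 'a='a] by (simp add: Suc_leI)
  have B': "0 < B" using B by simp
  have dil: "dilate B P = open_cube c (B * ?s) U" "dilate B P' = open_cube c' (B * ?s') U'"
    using dilate_open_cube[OF c(2,1) B', of c] dilate_open_cube[OF c'(2,1) B', of c'] c(3) c'(3)
    by simp_all
  obtain w where w: "w \<in> open_cube c (B * ?s) U" "w \<in> open_cube c' (B * ?s') U'"
    using meet unfolding dil by blast
  have "norm (p - c) \<le> ?s * ?d / 2" using open_cube_norm_le[OF c(2) _ c(1)] p c(3) by blast
  moreover have "norm (w - c) \<le> B * ?s * ?d / 2" "norm (w - c') \<le> B * ?s' * ?d / 2"
    using open_cube_norm_le[OF c(2) w(1)] open_cube_norm_le[OF c'(2) w(2)] B' c(1) c'(1) by simp_all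
  moreover have "norm (p - c') \<le> norm (p - c) + norm (w - c) + norm (w - c')"
    using norm_triangle_ineq[of "(p - c) - (w - c)" "w - c'"] norm_triangle_ineq4[of "p - c" "w - c"]
    by simp
  moreover have "?s * ?d \<le> B * ?s' * ?d"
    using mult_mono[of 1 B ?s ?s'] B le c(1) d by (intro mult_right_mono) auto
  moreover have "B * ?s * ?d \<le> B * ?s' * ?d"
    using B le d by (intro mult_right_mono mult_left_mono) auto
  moreover have "0 < B * ?s' * ?d" using B' c'(1) d by simp
  ultimately have "norm (p - c') < 5 * (B * ?s' * ?d) / 2" by linarith
  then have "norm (p - c') < (5 * B * ?d * ?s') / 2" by (simp add: mult_ac)
  then have "p \<in> open_cube c' (5 * B * ?d * ?s') U'" by (rule mem_open_cube_if_close[OF c'(2)])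
  also have "\<dots> = dilate (5 * B * ?d) P'"
    using dilate_open_cube[OF c'(2,1), of "5 * B * ?d" c'] B' d c'(3) by simp
  finally show "p \<in> dilate (5 * B * ?d) P'" .
qed

text \<open>\<open>m\<close> is half the essential infimum, since the defining \<open>Liminf\<close>
  directly yields almost everywhere lower bounds strictly below it. The halving is the source of the
  2 in \<open>2 * E * m\<close>.\<close>

lemma density_bounds:
  fixes f :: "'a::euclidean_space \<Rightarrow> real"
  assumes f[measurable]: "f \<in> borel_measurable borel" and Q: "Q \<in> sets borel" "emeasure lborel Q \<noteq> 0"
    and pos: "dens_inf f Q > 0" and ratio: "dens_sup f Q / dens_inf f Q \<le> ennreal E" and E: "0 < E"
  shows "\<exists>m>0. AE x in lborel. x \<in> Q \<longrightarrow> m \<le> f x \<and> f x \<le> 2 * E * m"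
proof -
  let ?M = "restrict_space lborel Q"
  define a where "a = dens_inf f Q"
  have fm: "(\<lambda>x. ennreal (f x)) \<in> borel_measurable ?M"
    by (intro measurable_restrict_space1) measurable
  have a: "a = Liminf (ae_filter ?M) (\<lambda>x. ennreal (f x))"
    using fm unfolding a_def dens_inf_def essinf_def by simp
  have AE_restrict: "(AE x in ?M. R x) \<longleftrightarrow> (AE x in lborel. x \<in> Q \<longrightarrow> R x)" for R
    using Q by (intro AE_restrict_space_iff) auto
  have below: "AE x in lborel. x \<in> Q \<longrightarrow> y < ennreal (f x)" if "y < a" for y
    using less_LiminfD[of y, OF that[unfolded a]] unfolding AE_restrict .
  \<comment> \<open>An infinite infimum would make the real-valued \<open>f\<close> exceed every
    integer almost everywhere on \<open>Q\<close>, a set of positive measure.\<close>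
  have "a \<noteq> \<top>"
  proof
    assume top: "a = \<top>"
    have "AE x in lborel. \<forall>n::nat. x \<in> Q \<longrightarrow> of_nat n < ennreal (f x)"
      using below by (intro AE_all_countable[THEN iffD2] allI) (simp add: top of_nat_less_top)
    then have "AE x in lborel. x \<notin> Q"
    proof (rule AE_mp, intro AE_I2 impI notI)
      fix x assume "\<forall>n::nat. x \<in> Q \<longrightarrow> of_nat n < ennreal (f x)" "x \<in> Q"
      then have "\<And>n. of_nat n < ennreal (f x)" by blast
      moreover obtain n :: nat where "ennreal (f x) < of_nat n"
        using ennreal_Ex_less_of_nat[of "ennreal (f x)"] by auto
      ultimately show False by (metis less_asym)
    qed
    then show False using Q AE_iff_measurable[of Q lborel "\<lambda>x. x \<notin> Q"] by auto
  qed
  then obtain r where r: "a = ennreal r" "0 < r"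
    using pos unfolding a_def[symmetric] by (cases a) auto
  have "dens_sup f Q = dens_sup f Q / a * a"
    by (simp only: ennreal_divide_times) (use r in simp)
  also have "\<dots> \<le> ennreal E * a" using ratio by (intro mult_right_mono) (auto simp: a_def)
  finally have sup: "dens_sup f Q \<le> ennreal (E * r)" using r E by (simp add: ennreal_mult)
  have "AE x in lborel. x \<in> Q \<longrightarrow> ennreal (f x) \<le> dens_sup f Q"
    using esssup_AE[of "\<lambda>x. ennreal (f x)" ?M] unfolding AE_restrict dens_sup_def .
  moreover have "AE x in lborel. x \<in> Q \<longrightarrow> ennreal (r / 2) < ennreal (f x)"
    using r by (intro below) (auto simp: ennreal_less_iff)
  ultimately have "AE x in lborel. x \<in> Q \<longrightarrow> r / 2 \<le> f x \<and> f x \<le> 2 * E * (r / 2)"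
  proof eventually_elim
    case (elim x)
    show ?case
    proof (intro impI conjI)
      assume "x \<in> Q"
      then have "ennreal (f x) \<le> ennreal (E * r)" "ennreal (r / 2) < ennreal (f x)"
        using elim sup order_trans by auto
      then show "r / 2 \<le> f x" "f x \<le> 2 * E * (r / 2)"
        using r E by (auto simp: ennreal_less_iff ennreal_le_iff2)
    qed
  qed
  then show ?thesis using r by (intro exI[of _ "r / 2"]) auto
qed

section \<open>Densities satisfying the Boman chain condition\<close>

context compact_conjugate
begin

text \<open>The point \<open>y = gradient \<phi> z\<close> is a competitor in the supremum for the
  second conjugate at \<open>z - w\<close> and a subgradient of \<phi> at \<open>z\<close>. Because
  the shifts are opposite, the two terms \<open>w \<bullet> y\<close> cancel and the bound is
  uniform in \<open>w\<close>.\<close>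

lemma gap_le_bregman:
  assumes "compact_conjugate Y \<psi>1" and z: "z \<notin> singular"
  shows "bregman_gap \<phi> (conjugate Y \<psi>1) z
    \<le> ennreal (conjugate Y \<psi>1 z - \<phi> z + (\<psi>1 (gradient \<phi> z) - \<psi> (gradient \<phi> z)))"
  unfolding bregman_gap_def
proof (intro SUP_least ennreal_leI)
  fix w
  interpret c1: compact_conjugate Y \<psi>1 by fact
  define y where "y = gradient \<phi> z"
  have y: "y \<in> maximizers z" unfolding y_def by (rule gradient_regular[OF z])
  then have yY: "y \<in> Y" and eq: "\<phi> z = z \<bullet> y - \<psi> y" by (auto simp: maximizers_def)
  have "(z - w) \<bullet> y - \<psi>1 y \<le> conjugate Y \<psi>1 (z - w)" by (rule c1.conjugate_ge[OF yY])
  then show "conjugate Y \<psi>1 z - conjugate Y \<psi>1 (z - w) + \<phi> z - \<phi> (z + w)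
      \<le> conjugate Y \<psi>1 z - \<phi> z + (\<psi>1 (gradient \<phi> z) - \<psi> (gradient \<phi> z))"
    using conjugate_subgradient[OF y, of w] eq unfolding y_def[symmetric]
    by (simp add: inner_diff_left)
qed

end

section \<open>Consequences of the chain condition for the domain, the measure and the cubes\<close>

locale boman_density =
  fixes X :: "'a::euclidean_space set" and f :: "'a \<Rightarrow> real"
    and F :: "'a set set" and A B C D E :: real
  assumes density: "prob_density_on X f"
    and boman: "boman_chain (dens_measure f) X F A B C"
    and D_pos: "D > 0"
    and doubling: "\<forall>Q\<in>F. measure (dens_measure f) (dilate (5 * B * sqrt (real DIM('a))) Q)
        \<le> D * measure (dens_measure f) Q"
    and E_pos: "E > 0"
    and inf_pos: "\<forall>Q\<in>F. dens_inf f Q > 0"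
    and ratio: "(SUP Q\<in>F. dens_sup f Q / dens_inf f Q) \<le> ennreal E"
begin

abbreviation \<rho> :: "'a measure" where "\<rho> \<equiv> dens_measure f"

lemma f_measurable [measurable]: "f \<in> borel_measurable borel"
  and f_zero: "x \<notin> X \<Longrightarrow> f x = 0"
  and f_integral: "(\<integral>\<^sup>+x. ennreal (f x) \<partial>lborel) = 1"
  using density by (auto simp: prob_density_on_def)

lemma sets_\<rho> [simp, measurable_cong]: "sets \<rho> = sets borel"
  and space_\<rho> [simp]: "space \<rho> = UNIV"
  by (auto simp: dens_measure_def)

lemma nn_integral_\<rho>:
  "g \<in> borel_measurable borel \<Longrightarrow> (\<integral>\<^sup>+x. g x \<partial>\<rho>) = (\<integral>\<^sup>+x. ennreal (f x) * g x \<partial>lborel)"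
  by (simp add: dens_measure_def nn_integral_density)

sublocale prob_space \<rho>
proof
  show "emeasure \<rho> (space \<rho>) = 1"
    using f_integral by (simp add: dens_measure_def emeasure_density)
qed

lemma AE_\<rho>_in_X: "AE x in \<rho>. x \<in> X"
proof -
  have "AE x in lborel. 0 < ennreal (f x) \<longrightarrow> x \<in> X" using f_zero by (intro AE_I2) force
  then show ?thesis unfolding dens_measure_def by (subst AE_density) auto
qed

lemma AE_\<rho>_if_AE_lborel: "AE x in lborel. R x \<Longrightarrow> AE x in \<rho>. R x"
  unfolding dens_measure_def by (subst AE_density) (auto elim: eventually_mono)

lemma parameters: "1 < A" "1 < B" "1 < C"
  and cube: "Q \<in> F \<Longrightarrow> is_open_cube Q"
  and cover: "X \<subseteq> \<Union>F"
proof -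
  have *: "1 < A \<and> 1 < B \<and> 1 < C \<and> (\<forall>Q\<in>F. is_open_cube Q) \<and> X \<subseteq> \<Union>F"
    using boman unfolding boman_chain_def by (elim conjE, intro conjI)
  show "1 < A" "1 < B" "1 < C" "Q \<in> F \<Longrightarrow> is_open_cube Q" "X \<subseteq> \<Union>F"
    using * by blast+
qed

definition is_chain :: "'a set \<Rightarrow> 'a set \<Rightarrow> nat \<Rightarrow> (nat \<Rightarrow> 'a set) \<Rightarrow> bool" where
  "is_chain Q0 Q N P \<longleftrightarrow> P 0 = Q0 \<and> P N = Q \<and> (\<forall>j\<le>N. P j \<in> F) \<and> inj_on P {..N} \<and>
        (\<forall>j<N. Q \<subseteq> dilate B (P j)) \<and>
        (\<forall>j<N. measure \<rho> (P j \<inter> P (Suc j))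
                 \<ge> inverse C * max (measure \<rho> (P j)) (measure \<rho> (P (Suc j))))"

lemma chains:
  obtains Q0 where "Q0 \<in> F" "\<And>Q. Q \<in> F \<Longrightarrow> \<exists>N P. is_chain Q0 Q N P"
proof -
  have "\<exists>Q0\<in>F. \<forall>Q\<in>F. \<exists>N P. is_chain Q0 Q N P"
    using boman unfolding boman_chain_def is_chain_def by (elim conjE)
  then show ?thesis using that by blast
qed

lemma sets_cube [measurable]: "Q \<in> F \<Longrightarrow> Q \<in> sets borel"
  using is_open_cube_props(1)[OF cube] by auto

lemma overlap_infsum:
  "(\<Sum>\<^sub>\<infinity>Q\<in>F. (indicator (dilate (min (10 / 9) ((real DIM('a) + 1) / real DIM('a))) Q) x :: ennreal))
    \<le> ennreal A * indicator X x"
  using boman unfolding boman_chain_def Let_def by (elim conjE) (erule spec)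

text \<open>A finite partial sum of the overlap condition, with each dilated cube shrunk to the cube
  itself. The factor \<open>indicator X x\<close> is kept because it confines the cubes to
  \<open>X\<close>.\<close>

lemma overlap_finite:
  assumes G: "finite G" "G \<subseteq> F"
  shows "(\<Sum>P\<in>G. indicator P x :: ennreal) \<le> ennreal A * indicator X x"
proof -
  let ?\<sigma> = "min (10 / 9) ((real DIM('a) + 1) / real DIM('a))"
  have "1 \<le> ?\<sigma>" using DIM_positive[where 'a='a] by (simp add: field_simps)
  then have "(\<Sum>P\<in>G. indicator P x :: ennreal) \<le> (\<Sum>P\<in>G. indicator (dilate ?\<sigma> P) x)"
    using subset_dilate[OF cube] G(2)
    by (intro sum_mono) (simp add: indicator_def subset_iff)
  also have "\<dots> \<le> (\<Sum>\<^sub>\<infinity>Q\<in>F. indicator (dilate ?\<sigma> Q) x)"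
    using G by (subst nonneg_infsum_complete) (use G in \<open>auto intro!: SUP_upper\<close>)
  also note overlap_infsum
  finally show ?thesis .
qed

lemma overlap_real:
  assumes G: "finite G" "G \<subseteq> F"
  shows "(\<Sum>P\<in>G. indicator P x :: real) \<le> A"
proof -
  have "ennreal (\<Sum>P\<in>G. indicator P x) = (\<Sum>P\<in>G. indicator P x)"
    by (simp add: sum_ennreal[symmetric] ennreal_indicator)
  also have "\<dots> \<le> ennreal A * indicator X x" by (rule overlap_finite[OF G])
  also have "\<dots> \<le> ennreal A" by (auto split: split_indicator)
  finally show ?thesis using parameters by (subst (asm) ennreal_le_iff) auto
qed

lemma cube_subset_X:
  assumes "Q \<in> F"
  shows "Q \<subseteq> X"
proof (rule subsetI, rule ccontr)
  fix x assume "x \<in> Q" "x \<notin> X"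
  then show False using overlap_finite[of "{Q}" x] assms by simp
qed

text \<open>Each chain starts at the central cube, so its first inclusion puts every
  \<open>Q\<close> inside \<open>dilate B Q0\<close>. Boundedness gives the bound on segment lengths
  and the integrability of the conjugates.\<close>

lemma bounded_X: "bounded X"
proof -
  obtain Q0 where Q0: "Q0 \<in> F" "\<And>Q. Q \<in> F \<Longrightarrow> \<exists>N P. is_chain Q0 Q N P"
    using chains by blast
  have "Q \<subseteq> dilate B Q0" if Q: "Q \<in> F" for Q
  proof -
    obtain N :: nat and P where P: "P 0 = Q0" "P N = Q" "\<And>j. j < N \<Longrightarrow> Q \<subseteq> dilate B (P j)"
      using Q0(2)[OF Q] unfolding is_chain_def by blast
    show ?thesis
    proof (cases "N = 0")
      case True
      then show ?thesis using P(1,2) subset_dilate[OF cube[OF Q0(1)], of B] parameters by auto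
    next
      case False
      then show ?thesis using P(1) P(3)[of 0] by simp
    qed
  qed
  then have "X \<subseteq> dilate B Q0" using cover by blast
  moreover have "bounded (dilate B Q0)"
    using is_open_cube_props(3)[OF is_open_cube_dilate[OF cube[OF Q0(1)]]] parameters by auto
  ultimately show ?thesis by (rule bounded_subset[rotated])
qed

lemma density_bounds_cube:
  assumes "Q \<in> F"
  shows "\<exists>m>0. AE x in lborel. x \<in> Q \<longrightarrow> m \<le> f x \<and> f x \<le> 2 * E * m"
proof (rule density_bounds)
  show "dens_sup f Q / dens_inf f Q \<le> ennreal E"
    using ratio assms by (meson SUP_upper order_trans)
qed (use assms inf_pos E_pos emeasure_open_cube[OF cube] in auto)

lemma measure_cube_pos:
  assumes Q: "Q \<in> F"
  shows "0 < measure \<rho> Q"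
proof -
  obtain m where m: "0 < m" "AE x in lborel. x \<in> Q \<longrightarrow> m \<le> f x \<and> f x \<le> 2 * E * m"
    using density_bounds_cube[OF Q] by blast
  have "0 < ennreal m * emeasure lborel Q"
    using m(1) emeasure_open_cube(1)[OF cube[OF Q]] by (simp add: ennreal_zero_less_mult_iff zero_less_iff_neq_zero)
  also have "\<dots> = (\<integral>\<^sup>+x. ennreal m * indicator Q x \<partial>lborel)"
    using Q by (simp add: nn_integral_cmult_indicator)
  also have "\<dots> \<le> (\<integral>\<^sup>+x. ennreal (f x) * indicator Q x \<partial>lborel)"
    using m(2) by (intro nn_integral_mono_AE) (auto elim!: eventually_mono intro!: ennreal_leI split: split_indicator)
  also have "\<dots> = emeasure \<rho> Q"
    using Q by (simp add: dens_measure_def emeasure_density)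
  finally show ?thesis by (simp add: emeasure_eq_measure)
qed

lemma integrable_continuous:
  fixes g :: "'a \<Rightarrow> real"
  assumes g: "continuous_on UNIV g"
  shows "integrable \<rho> g"
proof -
  have "compact (g ` closure X)"
    using bounded_X by (intro compact_continuous_image continuous_on_subset[OF g]) (auto simp: compact_closure)
  then have "bounded (g ` closure X)" by (rule compact_imp_bounded)
  then obtain b where "\<And>x. x \<in> closure X \<Longrightarrow> norm (g x) \<le> b" unfolding bounded_iff by blast
  then have "\<And>x. x \<in> X \<Longrightarrow> norm (g x) \<le> b" using closure_subset by blast
  then have "AE x in \<rho>. norm (g x) \<le> b" using AE_\<rho>_in_X by (auto elim: eventually_mono)
  moreover have "g \<in> borel_measurable borel" using g by (rule borel_measurable_continuous_onI)
  ultimately show ?thesis by (intro integrable_const_bound) (auto simp: measurable_cong_sets[OF sets_\<rho> refl])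
qed

text \<open>On \<open>Q\<close> the density lies between \<open>m\<close> and
  \<open>2 * E * m\<close>: the upper bound is spent on the left side, the lower one on the right,
  and \<open>m\<close> cancels.\<close>

lemma local_estimate_density:
  assumes Q: "Q \<in> F"
    and g[measurable]: "g \<in> borel_measurable borel" and v[measurable]: "v \<in> borel_measurable borel"
    and K: "0 \<le> K"
    and seg: "\<And>x y. x \<in> Q \<Longrightarrow> y \<in> Q \<Longrightarrow> ennreal ((v y - v x)\<^sup>2)
      \<le> ennreal K * (\<integral>\<^sup>+t. g (x + t *\<^sub>R (y - x)) * indicator {0..1} t \<partial>lborel)"
  shows "\<exists>c. (\<integral>\<^sup>+x. ennreal (indicator Q x * (v x - c)\<^sup>2) \<partial>\<rho>)
    \<le> ennreal (2 * E * K * 2 ^ DIM('a)) * (\<integral>\<^sup>+x. g x * indicator Q x \<partial>\<rho>)"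
proof -
  note [measurable] = sets_cube[OF Q]
  obtain m where m: "0 < m" "AE x in lborel. x \<in> Q \<longrightarrow> m \<le> f x \<and> f x \<le> 2 * E * m"
    using density_bounds_cube[OF Q] by blast
  obtain c where c: "(\<integral>\<^sup>+x. ennreal ((v x - c)\<^sup>2) * indicator Q x \<partial>lborel)
    \<le> ennreal K * 2 ^ DIM('a) * (\<integral>\<^sup>+z. g z * indicator Q z \<partial>lborel)"
    using local_estimate[OF is_open_cube_props(2)[OF cube[OF Q]] sets_cube[OF Q] g v
        emeasure_open_cube[OF cube[OF Q]] seg] ..
  have "(\<integral>\<^sup>+x. ennreal (indicator Q x * (v x - c)\<^sup>2) \<partial>\<rho>)
      = (\<integral>\<^sup>+x. ennreal (f x) * (ennreal ((v x - c)\<^sup>2) * indicator Q x) \<partial>lborel)"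
    by (subst nn_integral_\<rho>) (auto intro!: nn_integral_cong split: split_indicator)
  also have "\<dots> \<le> (\<integral>\<^sup>+x. ennreal (2 * E * m) * (ennreal ((v x - c)\<^sup>2) * indicator Q x) \<partial>lborel)"
    using m(2) by (intro nn_integral_mono_AE)
      (auto elim!: eventually_mono intro!: mult_right_mono ennreal_leI split: split_indicator)
  also have "\<dots> = ennreal (2 * E * m) * (\<integral>\<^sup>+x. ennreal ((v x - c)\<^sup>2) * indicator Q x \<partial>lborel)"
    by (intro nn_integral_cmult) measurable
  also have "\<dots> \<le> ennreal (2 * E * m) * (ennreal K * 2 ^ DIM('a) * (\<integral>\<^sup>+z. g z * indicator Q z \<partial>lborel))"
    by (intro mult_left_mono c) simp
  also have "\<dots> = ennreal (2 * E * K * 2 ^ DIM('a)) * (ennreal m * (\<integral>\<^sup>+z. g z * indicator Q z \<partial>lborel))"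
  proof -
    have "ennreal (2 * E * m) * (ennreal K * 2 ^ DIM('a)) = ennreal (2 * E * K * 2 ^ DIM('a)) * ennreal m"
    proof -
      have "(2::ennreal) ^ DIM('a) = ennreal (2 ^ DIM('a))"
        using ennreal_power[of 2 "DIM('a)"] by simp
      moreover have "2 * E * m * (K * 2 ^ DIM('a)) = 2 * E * K * 2 ^ DIM('a) * m" by simp
      ultimately show ?thesis using E_pos K m(1) by (simp only: ennreal_mult[symmetric] mult_nonneg_nonneg zero_le_power zero_le_numeral less_imp_le)
    qed
    then show ?thesis by (simp only: mult.assoc[symmetric])
  qed
  also have "ennreal m * (\<integral>\<^sup>+z. g z * indicator Q z \<partial>lborel) = (\<integral>\<^sup>+z. ennreal m * (g z * indicator Q z) \<partial>lborel)"
    by (intro nn_integral_cmult[symmetric]) measurable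
  also have "\<dots> \<le> (\<integral>\<^sup>+z. ennreal (f z) * (g z * indicator Q z) \<partial>lborel)"
    using m(2) by (intro nn_integral_mono_AE)
      (auto elim!: eventually_mono intro!: mult_right_mono ennreal_leI split: split_indicator)
  also have "\<dots> = (\<integral>\<^sup>+x. g x * indicator Q x \<partial>\<rho>)"
    by (subst nn_integral_\<rho>) auto
  finally have "(\<integral>\<^sup>+x. ennreal (indicator Q x * (v x - c)\<^sup>2) \<partial>\<rho>)
    \<le> ennreal (2 * E * K * 2 ^ DIM('a)) * (\<integral>\<^sup>+x. g x * indicator Q x \<partial>\<rho>)"
    by (simp only: mult_left_mono zero_le)
  then show ?thesis ..
qed

lemma sum_integrals_le:
  assumes "finite G" "G \<subseteq> F" and g[measurable]: "g \<in> borel_measurable borel"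
  shows "(\<Sum>P\<in>G. \<integral>\<^sup>+x. g x * indicator P x \<partial>\<rho>) \<le> ennreal A * (\<integral>\<^sup>+x. g x \<partial>\<rho>)"
proof -
  have "(\<Sum>P\<in>G. \<integral>\<^sup>+x. g x * indicator P x \<partial>\<rho>) = (\<integral>\<^sup>+x. (\<Sum>P\<in>G. g x * indicator P x) \<partial>\<rho>)"
    using assms(2) by (intro nn_integral_sum[symmetric]) auto
  also have "\<dots> \<le> (\<integral>\<^sup>+x. ennreal A * g x \<partial>\<rho>)"
  proof (rule nn_integral_mono)
    fix x
    have "(\<Sum>P\<in>G. g x * indicator P x) = g x * (\<Sum>P\<in>G. indicator P x)" by (simp add: sum_distrib_left)
    also have "\<dots> \<le> g x * ennreal A"
      using overlap_finite[OF assms(1,2), of x] by (intro mult_left_mono) (auto split: split_indicator_asm)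
    finally show "(\<Sum>P\<in>G. g x * indicator P x) \<le> ennreal A * g x" by (simp add: mult.commute)
  qed
  also have "\<dots> = ennreal A * (\<integral>\<^sup>+x. g x \<partial>\<rho>)" by (intro nn_integral_cmult) auto
  finally show ?thesis .
qed

lemma dilated_family_cubes:
  assumes G: "finite G" "G \<subseteq> F"
  shows "dilated_family \<rho> G (dilate B) (dilate (5 * B * sqrt (real DIM('a)))) cube_side A D"
proof (intro dilated_family.intro dilated_family_axioms.intro)
  have d: "1 \<le> sqrt (real DIM('a))" using DIM_positive[where 'a='a] by (simp add: Suc_leI)
  then have "B * 1 \<le> B * (5 * sqrt (real DIM('a)))"
    using parameters by (intro mult_left_mono) linarith+
  then have B5: "B \<le> 5 * B * sqrt (real DIM('a))" by (simp add: mult_ac)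
  have pos: "0 < B" "0 < 5 * B * sqrt (real DIM('a))" using B5 parameters by linarith+
  show "finite_measure \<rho>" by unfold_locales
  show "finite G" by (rule G)
  show "0 < A" using parameters by simp
  show "0 < D" by (rule D_pos)
  show "(\<Sum>P\<in>G. indicator P x) \<le> A" for x by (rule overlap_real[OF G])
  fix P assume "P \<in> G"
  then have PF: "P \<in> F" using G by auto
  note dil = is_open_cube_dilate[OF cube[OF PF] pos(1)] is_open_cube_dilate[OF cube[OF PF] pos(2)]
  show "P \<in> sets \<rho>" using sets_cube[OF PF] by simp
  show "dilate B P \<in> sets \<rho>" using is_open_cube_props(1)[OF dil(1)] by simp
  show "dilate (5 * B * sqrt (real DIM('a))) P \<in> sets \<rho>"
    using is_open_cube_props(1)[OF dil(2)] by simp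
  show "P \<subseteq> dilate B P" using subset_dilate[OF cube[OF PF]] parameters by simp
  show "dilate B P \<subseteq> dilate (5 * B * sqrt (real DIM('a))) P"
    by (rule dilate_subset[OF cube[OF PF] pos(1) B5])
  show "0 < measure \<rho> P" by (rule measure_cube_pos[OF PF])
  show "measure \<rho> (dilate (5 * B * sqrt (real DIM('a))) P) \<le> D * measure \<rho> P"
    using doubling PF by blast
  fix P' assume P': "P' \<in> G" "dilate B P \<inter> dilate B P' \<noteq> {}" "cube_side P \<le> cube_side P'"
  have "P' \<in> F" "1 \<le> B" using P'(1) G(2) parameters by auto
  then show "P \<subseteq> dilate (5 * B * sqrt (real DIM('a))) P'"
    by (intro cube_engulf[OF cube[OF PF] cube _ P'(2,3)])
qed

text \<open>For a finite \<open>H\<close>, the cubes in the chosen chains form a finite family, and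
  the resulting bound does not depend on \<open>H\<close>. Finite unions then exhaust
  \<open>X\<close>, and monotone convergence gives the bound on all of \<open>X\<close>.\<close>

lemma gluing:
  assumes v: "continuous_on UNIV v" and g[measurable]: "g \<in> borel_measurable borel"
    and K: "0 \<le> K" and T: "0 \<le> T" "(\<integral>\<^sup>+x. g x \<partial>\<rho>) \<le> ennreal T"
    and loc: "\<And>Q. Q \<in> F \<Longrightarrow> \<exists>c. (\<integral>\<^sup>+x. ennreal (indicator Q x * (v x - c)\<^sup>2) \<partial>\<rho>)
        \<le> ennreal K * (\<integral>\<^sup>+x. g x * indicator Q x \<partial>\<rho>)"
  shows "Var \<rho> v \<le> (2 + 128 * C * A\<^sup>2 * D ^ 3) * (K * (A * T))"
proof -
  have vm[measurable]: "v \<in> borel_measurable borel" using v by (rule borel_measurable_continuous_onI)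
  obtain c where c: "\<And>Q. Q \<in> F \<Longrightarrow> (\<integral>\<^sup>+x. ennreal (indicator Q x * (v x - c Q)\<^sup>2) \<partial>\<rho>)
        \<le> ennreal K * (\<integral>\<^sup>+x. g x * indicator Q x \<partial>\<rho>)"
    using loc by metis
  have iv: "integrable \<rho> v" and iv2: "integrable \<rho> (\<lambda>x. (v x)\<^sup>2)" and ivc: "integrable \<rho> (\<lambda>x. (v x - k)\<^sup>2)" for k
    using v by (auto intro!: integrable_continuous continuous_intros)
  obtain Q0 where Q0: "Q0 \<in> F" and ch: "\<And>Q. Q \<in> F \<Longrightarrow> \<exists>N P. is_chain Q0 Q N P"
    using chains by blast
  define W where "W = (2 + 128 * C * A\<^sup>2 * D ^ 3) * (K * (A * T))"
  have finite_part: "(\<integral>\<^sup>+x. ennreal (indicator (\<Union>H) x * (v x - c Q0)\<^sup>2) \<partial>\<rho>) \<le> ennreal W"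
    if H: "finite H" "H \<subseteq> F" for H
  proof -
    obtain N P where NP: "\<And>Q. Q \<in> H \<Longrightarrow> is_chain Q0 Q (N Q) (P Q)"
      using ch H(2) by (metis subsetD)
    define G where "G = (\<Union>Q\<in>H. P Q ` {..N Q})"
    have G: "finite G" "G \<subseteq> F" using H(1) NP by (auto simp: G_def is_chain_def)
    have HG: "H \<subseteq> G"
    proof
      fix Q assume "Q \<in> H"
      moreover from this have "Q = P Q (N Q)" using NP by (simp add: is_chain_def)
      ultimately show "Q \<in> G" unfolding G_def by blast
    qed
    interpret dilated_family \<rho> G "dilate B" "dilate (5 * B * sqrt (real DIM('a)))" cube_side A D
      by (rule dilated_family_cubes[OF G])
    have glue: "(\<integral>x. indicator (\<Union>H) x * (v x - c Q0)\<^sup>2 \<partial>\<rho>)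
      \<le> (2 + 128 * C * A\<^sup>2 * D ^ 3) * (\<Sum>P\<in>G. \<integral>x. indicator P x * (v x - c P)\<^sup>2 \<partial>\<rho>)"
    proof (rule chain_gluing[OF iv iv2 HG])
      fix Q assume Q: "Q \<in> H"
      have "\<forall>j\<le>N Q. P Q j \<in> G" using Q by (auto simp: G_def)
      then show "\<exists>(n::nat) p. p 0 = Q0 \<and> p n = Q \<and> (\<forall>j\<le>n. p j \<in> G) \<and> inj_on p {..n}
        \<and> (\<forall>j<n. Q \<subseteq> dilate B (p j))
        \<and> (\<forall>j<n. measure \<rho> (p j \<inter> p (Suc j)) \<ge> inverse C * max (measure \<rho> (p j)) (measure \<rho> (p (Suc j))))"
        using NP[OF Q] unfolding is_chain_def by (intro exI[of _ "N Q"] exI[of _ "P Q"]) simp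
    qed (use parameters in auto)
    have ii: "integrable \<rho> (\<lambda>x. indicator S x * (v x - k)\<^sup>2)" if "S \<in> sets borel" for S k
      using integrable_mult_indicator[of S \<rho> "\<lambda>x. (v x - k)\<^sup>2"] that ivc by simp
    have en: "ennreal (\<integral>x. indicator S x * (v x - k)\<^sup>2 \<partial>\<rho>) = (\<integral>\<^sup>+x. ennreal (indicator S x * (v x - k)\<^sup>2) \<partial>\<rho>)"
      if "S \<in> sets borel" for S k
      using ii[OF that] by (intro nn_integral_eq_integral[symmetric]) auto
    have J0: "0 \<le> (\<integral>x. indicator S x * (v x - k)\<^sup>2 \<partial>\<rho>)" for S :: "'a set" and k
      by (intro Bochner_Integration.integral_nonneg) auto
    have "ennreal (\<Sum>P\<in>G. \<integral>x. indicator P x * (v x - c P)\<^sup>2 \<partial>\<rho>)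
        = (\<Sum>P\<in>G. \<integral>\<^sup>+x. ennreal (indicator P x * (v x - c P)\<^sup>2) \<partial>\<rho>)"
    proof -
      have "P \<in> sets borel" if "P \<in> G" for P using that G(2) sets_cube by blast
      then have "(\<Sum>P\<in>G. \<integral>\<^sup>+x. ennreal (indicator P x * (v x - c P)\<^sup>2) \<partial>\<rho>)
          = (\<Sum>P\<in>G. ennreal (\<integral>x. indicator P x * (v x - c P)\<^sup>2 \<partial>\<rho>))"
        by (intro sum.cong refl en[symmetric])
      then show ?thesis using sum_ennreal[OF J0] by simp
    qed
    also have "\<dots> \<le> (\<Sum>P\<in>G. ennreal K * (\<integral>\<^sup>+x. g x * indicator P x \<partial>\<rho>))"
      using G(2) by (intro sum_mono c) blast
    also have "\<dots> = ennreal K * (\<Sum>P\<in>G. \<integral>\<^sup>+x. g x * indicator P x \<partial>\<rho>)"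
      by (simp add: sum_distrib_left)
    also have "\<dots> \<le> ennreal K * (ennreal A * ennreal T)"
      by (intro mult_left_mono order_trans[OF sum_integrals_le[OF G g]] T(2)) auto
    also have "\<dots> = ennreal (K * (A * T))" using K T(1) parameters by (simp add: ennreal_mult)
    finally have "(\<Sum>P\<in>G. \<integral>x. indicator P x * (v x - c P)\<^sup>2 \<partial>\<rho>) \<le> K * (A * T)"
      using K T(1) parameters by (subst (asm) ennreal_le_iff) auto
    then have "(2 + 128 * C * A\<^sup>2 * D ^ 3) * (\<Sum>P\<in>G. \<integral>x. indicator P x * (v x - c P)\<^sup>2 \<partial>\<rho>) \<le> W"
      unfolding W_def using parameters D_pos by (intro mult_left_mono) auto
    then have "(\<integral>x. indicator (\<Union>H) x * (v x - c Q0)\<^sup>2 \<partial>\<rho>) \<le> W" using glue by linarith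
    moreover have "\<Union>H \<in> sets borel" using H by (intro sets.finite_Union) auto
    ultimately show ?thesis by (subst en[symmetric]) (auto intro: ennreal_leI)
  qed
  \<comment> \<open>A countable subcover by Lindelof. Inserting \<open>Q0\<close> below makes the
    enumerated set nonempty, so that it is exactly the range of
    \<open>from_nat_into\<close>.\<close>
  obtain F' where F': "F' \<subseteq> F" "countable F'" "\<Union>F' = \<Union>F"
    using Lindelof_openin[of F UNIV] is_open_cube_props(1)[OF cube] by auto
  define e where "e = from_nat_into (insert Q0 F')"
  have re: "range e = insert Q0 F'" unfolding e_def using F'(2) by (intro range_from_nat_into) auto
  define H where "H n = e ` {..n::nat}" for n
  have H: "finite (H n)" "H n \<subseteq> F" for n using re F'(1) Q0 by (auto simp: H_def)
  have [measurable]: "\<Union>(H n) \<in> sets borel" for n using H[of n] by (intro sets.finite_Union) auto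
  have "(\<integral>\<^sup>+x. ennreal ((v x - c Q0)\<^sup>2) \<partial>\<rho>)
      = (\<integral>\<^sup>+x. (SUP n. ennreal (indicator (\<Union>(H n)) x * (v x - c Q0)\<^sup>2)) \<partial>\<rho>)"
  proof (rule nn_integral_cong_AE, rule AE_mp[OF AE_\<rho>_in_X], intro AE_I2 impI)
    fix x assume "x \<in> X"
    then obtain Q where Q: "x \<in> Q" "Q \<in> F'" using cover F'(3) by blast
    then have "Q \<in> range e" unfolding re by blast
    then obtain n where "Q = e n" by blast
    then have n: "x \<in> \<Union>(H n)" using Q(1) unfolding H_def by blast
    show "ennreal ((v x - c Q0)\<^sup>2) = (SUP n. ennreal (indicator (\<Union>(H n)) x * (v x - c Q0)\<^sup>2))"
    proof (rule antisym)
      show "ennreal ((v x - c Q0)\<^sup>2) \<le> (SUP n. ennreal (indicator (\<Union>(H n)) x * (v x - c Q0)\<^sup>2))"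
        using n by (intro SUP_upper2[of n]) simp_all
      show "(SUP n. ennreal (indicator (\<Union>(H n)) x * (v x - c Q0)\<^sup>2)) \<le> ennreal ((v x - c Q0)\<^sup>2)"
        by (intro SUP_least ennreal_leI mult_left_le_one_le) simp_all
    qed
  qed
  also have "\<dots> = (SUP n. \<integral>\<^sup>+x. ennreal (indicator (\<Union>(H n)) x * (v x - c Q0)\<^sup>2) \<partial>\<rho>)"
  proof (rule nn_integral_monotone_convergence_SUP)
    show "incseq (\<lambda>n x. ennreal (indicator (\<Union>(H n)) x * (v x - c Q0)\<^sup>2))"
    proof (intro incseq_SucI le_funI ennreal_leI mult_right_mono)
      fix n x
      have "\<Union>(H n) \<subseteq> \<Union>(H (Suc n))" unfolding H_def by (intro Union_mono image_mono) auto
      then show "indicator (\<Union>(H n)) x \<le> (indicator (\<Union>(H (Suc n))) x :: real)"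
        by (auto split: split_indicator)
    qed auto
  qed auto
  also have "\<dots> \<le> ennreal W" by (intro SUP_least finite_part H)
  finally have "ennreal (\<integral>x. (v x - c Q0)\<^sup>2 \<partial>\<rho>) \<le> ennreal W"
    using ivc by (subst nn_integral_eq_integral[symmetric]) auto
  moreover have "0 \<le> W" unfolding W_def using parameters D_pos K T(1) by auto
  ultimately have le: "(\<integral>x. (v x - c Q0)\<^sup>2 \<partial>\<rho>) \<le> W" by (simp add: ennreal_le_iff)
  \<comment> \<open>The mean minimises the mean square deviation, so the deviation from
    \<open>c Q0\<close> bounds the variance.\<close>
  have "(\<integral>x. (v x - c Q0)\<^sup>2 \<partial>\<rho>) = (\<integral>x. (v x)\<^sup>2 \<partial>\<rho>) - 2 * c Q0 * (\<integral>x. v x \<partial>\<rho>) + (c Q0)\<^sup>2"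
    using iv iv2 by (simp add: power2_diff prob_space[simplified] mult_ac)
  then have "Var \<rho> v = (\<integral>x. (v x - c Q0)\<^sup>2 \<partial>\<rho>) - ((\<integral>x. v x \<partial>\<rho>) - c Q0)\<^sup>2"
    unfolding Var_def by (simp add: power2_diff)
  then have "Var \<rho> v \<le> (\<integral>x. (v x - c Q0)\<^sup>2 \<partial>\<rho>)" by simp
  then show ?thesis using le unfolding W_def by simp
qed

lemma set_integral_X:
  assumes "integrable \<rho> g"
  shows "(LINT x:X|\<rho>. g x) = (\<integral>x. g x \<partial>\<rho>)"
proof -
  have "AE x in \<rho>. indicator X x *\<^sub>R g x = g x"
    using AE_\<rho>_in_X by eventually_elim simp
  moreover have X: "X \<in> sets borel"
  proof -
    have "X = \<Union>F" using cover cube_subset_X by blast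
    also have "open \<dots>" using is_open_cube_props(1)[OF cube] by blast
    finally show ?thesis by (rule borel_open)
  qed
  moreover have "g \<in> borel_measurable \<rho>" using assms by simp
  ultimately show ?thesis
    unfolding set_lebesgue_integral_def
    by (intro integral_cong_AE borel_measurable_scaleR borel_measurable_indicator) auto
qed

text \<open>The constant collects the gluing factor, \<open>2 * E\<close> from the density ratio,
  \<open>16 * R * L\<close> from segments, \<open>2 ^ DIM('a)\<close> from averaging over pairs, and
  the overlap \<open>A\<close> from summing over cubes.\<close>

lemma variance_bound:
  assumes R: "0 < R" "\<And>y. y \<in> Y \<Longrightarrow> norm y \<le> R"
    and L: "0 \<le> L" "\<And>x y. x \<in> X \<Longrightarrow> y \<in> X \<Longrightarrow> norm (y - x) \<le> L"
    and c0: "compact_conjugate Y \<psi>0" and c1: "compact_conjugate Y \<psi>1"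
  shows "Var \<rho> (\<lambda>x. conjugate Y \<psi>1 x - conjugate Y \<psi>0 x)
    \<le> (2 + 128 * C * A\<^sup>2 * D ^ 3) * (2 * E * (16 * R * L) * 2 ^ DIM('a)) * A
      * (kantorovich \<rho> X Y \<psi>1 - kantorovich \<rho> X Y \<psi>0
         + (LINT y:Y|distr \<rho> borel (gradient (conjugate Y \<psi>0)). \<psi>1 y - \<psi>0 y))"
proof -
  interpret c0: compact_conjugate Y \<psi>0 by fact
  interpret c1: compact_conjugate Y \<psi>1 by fact
  let ?\<phi>0 = "conjugate Y \<psi>0" and ?\<phi>1 = "conjugate Y \<psi>1"
  define gap where "gap = bregman_gap ?\<phi>0 ?\<phi>1"
  \<comment> \<open>Extended by 0 outside \<open>Y\<close>: this makes it Borel on the whole space,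
    as the change of variables for \<open>distr\<close> requires, and fixes its value at the default
    gradient 0 when 0 is not in \<open>Y\<close>.\<close>
  define u where "u y = indicator Y y *\<^sub>R (\<psi>1 y - \<psi>0 y)" for y
  define d where "d x = ?\<phi>1 x - ?\<phi>0 x + u (gradient ?\<phi>0 x)" for x
  have gapm[measurable]: "gap \<in> borel_measurable borel"
    unfolding gap_def by (rule bregman_gap_measurable[OF c0.continuous_conjugate c1.continuous_conjugate])
  have u[measurable]: "u \<in> borel_measurable borel"
  proof -
    have "u = (\<lambda>y. if y \<in> Y then \<psi>1 y - \<psi>0 y else 0)" by (auto simp: u_def)
    moreover have "\<dots> \<in> borel_measurable borel"
      using c0.compact_Y c0.cont c1.cont
      by (intro borel_measurable_continuous_on_if) (auto intro!: continuous_intros borel_closed compact_imp_closed)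
    ultimately show ?thesis by simp
  qed
  note grad[measurable] = c0.gradient_measurable
  obtain b where b: "\<And>y. y \<in> Y \<Longrightarrow> norm (\<psi>1 y - \<psi>0 y) \<le> b"
  proof -
    have "compact ((\<lambda>y. \<psi>1 y - \<psi>0 y) ` Y)"
      using c0.compact_Y c0.cont c1.cont by (intro compact_continuous_image continuous_intros)
    then have "bounded ((\<lambda>y. \<psi>1 y - \<psi>0 y) ` Y)" by (rule compact_imp_bounded)
    then show ?thesis using that unfolding bounded_iff by blast
  qed
  have ub: "norm (u y) \<le> \<bar>b\<bar>" for y
    using b[of y] by (auto simp: u_def split: split_indicator)
  have i0: "integrable \<rho> ?\<phi>0" and i1: "integrable \<rho> ?\<phi>1"
    by (auto intro!: integrable_continuous c0.continuous_conjugate c1.continuous_conjugate)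
  have iu: "integrable \<rho> (\<lambda>x. u (gradient ?\<phi>0 x))"
    using ub by (intro integrable_const_bound[of _ "\<bar>b\<bar>"]) auto
  have id: "integrable \<rho> d" unfolding d_def using i0 i1 iu by simp
  \<comment> \<open>\<open>0 \<le> d x\<close> is the Fenchel-Young inequality for the second
    conjugate at the gradient point; it lets the integral of \<open>d\<close> be read as an
    \<open>ennreal\<close> integral.\<close>
  have ineq: "AE x in \<rho>. gap x \<le> ennreal (d x) \<and> 0 \<le> d x"
  proof -
    have "AE x in lborel. x \<notin> c0.singular" using c0.singular_null by (rule AE_not_in)
    then have "AE x in \<rho>. x \<notin> c0.singular" by (rule AE_\<rho>_if_AE_lborel)
    then show ?thesis
    proof eventually_elim
      case (elim x)
      have y: "gradient ?\<phi>0 x \<in> c0.maximizers x" by (rule c0.gradient_regular[OF elim])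
      then have Y: "gradient ?\<phi>0 x \<in> Y" by (simp add: c0.maximizers_def)
      have "x \<bullet> gradient ?\<phi>0 x - \<psi>1 (gradient ?\<phi>0 x) \<le> ?\<phi>1 x" by (rule c1.conjugate_ge[OF Y])
      moreover have "gap x \<le> ennreal (d x)"
        using c0.gap_le_bregman[OF c1 elim] Y by (simp add: gap_def d_def u_def)
      ultimately show ?case using y Y by (auto simp: c0.maximizers_def d_def u_def)
    qed
  qed
  define T where "T = (\<integral>x. d x \<partial>\<rho>)"
  have T0: "0 \<le> T" unfolding T_def by (rule integral_nonneg_AE) (use ineq in \<open>auto elim: eventually_mono\<close>)
  have T1: "(\<integral>\<^sup>+x. gap x \<partial>\<rho>) \<le> ennreal T"
  proof -
    have "(\<integral>\<^sup>+x. gap x \<partial>\<rho>) \<le> (\<integral>\<^sup>+x. ennreal (d x) \<partial>\<rho>)"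
      by (rule nn_integral_mono_AE) (use ineq in \<open>auto elim: eventually_mono\<close>)
    also have "\<dots> = ennreal T"
      unfolding T_def by (rule nn_integral_eq_integral[OF id]) (use ineq in \<open>auto elim: eventually_mono\<close>)
    finally show ?thesis .
  qed
  have T: "T = kantorovich \<rho> X Y \<psi>1 - kantorovich \<rho> X Y \<psi>0
         + (LINT y:Y|distr \<rho> borel (gradient ?\<phi>0). \<psi>1 y - \<psi>0 y)"
  proof -
    have "(LINT y:Y|distr \<rho> borel (gradient ?\<phi>0). \<psi>1 y - \<psi>0 y) = (\<integral>y. u y \<partial>distr \<rho> borel (gradient ?\<phi>0))"
      unfolding set_lebesgue_integral_def u_def ..
    also have "\<dots> = (\<integral>x. u (gradient ?\<phi>0 x) \<partial>\<rho>)" by (rule integral_distr) measurable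
    finally show ?thesis
      unfolding T_def d_def kantorovich_def set_integral_X[OF i0] set_integral_X[OF i1]
      using i0 i1 iu by simp
  qed
  have K: "0 \<le> 16 * R * L" using R(1) L(1) by simp
  have v: "continuous_on UNIV (\<lambda>x. ?\<phi>1 x - ?\<phi>0 x)"
    by (intro continuous_intros c0.continuous_conjugate c1.continuous_conjugate)
  have "Var \<rho> (\<lambda>x. ?\<phi>1 x - ?\<phi>0 x)
    \<le> (2 + 128 * C * A\<^sup>2 * D ^ 3) * (2 * E * (16 * R * L) * 2 ^ DIM('a) * (A * T))"
  proof (rule gluing[OF v gapm _ T0 T1])
    show "0 \<le> 2 * E * (16 * R * L) * 2 ^ DIM('a)" using K E_pos by simp
    fix Q assume Q: "Q \<in> F"
    show "\<exists>c. (\<integral>\<^sup>+x. ennreal (indicator Q x * (?\<phi>1 x - ?\<phi>0 x - c)\<^sup>2) \<partial>\<rho>)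
        \<le> ennreal (2 * E * (16 * R * L) * 2 ^ DIM('a)) * (\<integral>\<^sup>+x. gap x * indicator Q x \<partial>\<rho>)"
    proof (rule local_estimate_density[OF Q gapm borel_measurable_continuous_onI[OF v] K])
      fix x y assume "x \<in> Q" "y \<in> Q"
      then have "norm (y - x) \<le> L" using cube_subset_X[OF Q] L(2) by blast
      then show "ennreal ((?\<phi>1 y - ?\<phi>0 y - (?\<phi>1 x - ?\<phi>0 x))\<^sup>2)
        \<le> ennreal (16 * R * L) * (\<integral>\<^sup>+t. gap (x + t *\<^sub>R (y - x)) * indicator {0..1} t \<partial>lborel)"
        unfolding gap_def
        by (intro bregman_gap_segment[OF R(1)] c0.conjugate_lipschitz c1.conjugate_lipschitz R(2))
    qed
  qed
  then show ?thesis unfolding T[symmetric] by (simp only: mult.assoc)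
qed

end

theorem theorem2p7:
  fixes X :: "'a::euclidean_space set" and f :: "'a \<Rightarrow> real"
    and F :: "'a set set" and A B C D E :: real
  defines "\<rho> \<equiv> dens_measure f"
  assumes "open X" and "connected X"
    and "prob_density_on X f"
    and "boman_chain \<rho> X F A B C"
    and "D > 0"
    and "\<forall>Q\<in>F. measure \<rho> (dilate (5 * B * sqrt (real DIM('a))) Q) \<le> D * measure \<rho> Q"
    and "E > 0"
    and "\<forall>Q\<in>F. dens_inf f Q > 0"
    and "(SUP Q\<in>F. dens_sup f Q / dens_inf f Q) \<le> ennreal E"
  shows "\<forall>Y. compact Y \<longrightarrow>
    (\<exists>K>0. \<forall>\<psi>0\<in>C_b Y. \<forall>\<psi>1\<in>C_b Y.
       Var \<rho> (\<lambda>x. conjugate Y \<psi>1 x - conjugate Y \<psi>0 x)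
         \<le> K * (kantorovich \<rho> X Y \<psi>1 - kantorovich \<rho> X Y \<psi>0
                + (LINT y:Y|distr \<rho> borel (gradient (conjugate Y \<psi>0)). \<psi>1 y - \<psi>0 y)))"
proof (intro allI impI)
  fix Y :: "'a set" assume Y: "compact Y"
  interpret boman_density X f F A B C D E
    by (rule boman_density.intro) (use assms in \<open>simp_all only:\<close>)
  obtain R where R: "0 < R" "\<And>y. y \<in> Y \<Longrightarrow> norm y \<le> R"
    using compact_imp_bounded[OF Y] unfolding bounded_pos by blast
  obtain b where b: "0 < b" "\<And>x. x \<in> X \<Longrightarrow> norm x \<le> b"
    using bounded_X unfolding bounded_pos by blast
  have L: "norm (y - x) \<le> 2 * b" if "x \<in> X" "y \<in> X" for x y
    using norm_triangle_ineq4[of y x] b(2)[OF that(1)] b(2)[OF that(2)] by linarith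
  \<comment> \<open>Fixed before the potentials are chosen: \<open>2 * b\<close> bounds the diameter
    of \<open>X\<close> and \<open>R\<close> the Lipschitz constants of the conjugates.\<close>
  define K where "K = (2 + 128 * C * A\<^sup>2 * D ^ 3) * (2 * E * (16 * R * (2 * b)) * 2 ^ DIM('a)) * A"
  have "0 < K" unfolding K_def
    using parameters D_pos E_pos R(1) b(1) by (intro mult_pos_pos add_pos_nonneg) auto
  moreover have "Var \<rho> (\<lambda>x. conjugate Y \<psi>1 x - conjugate Y \<psi>0 x)
         \<le> K * (kantorovich \<rho> X Y \<psi>1 - kantorovich \<rho> X Y \<psi>0
                + (LINT y:Y|distr \<rho> borel (gradient (conjugate Y \<psi>0)). \<psi>1 y - \<psi>0 y))"
    if \<psi>: "\<psi>0 \<in> C_b Y" "\<psi>1 \<in> C_b Y" for \<psi>0 \<psi>1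
  proof (cases "Y = {}")
    case True
    \<comment> \<open>For empty \<open>Y\<close> both conjugates are the same constant, the real
      supremum of the empty set, and both sides vanish.\<close>
    have "conjugate Y \<psi>1 = conjugate Y \<psi>0" by (simp add: True conjugate_def fun_eq_iff)
    then show ?thesis by (simp add: True kantorovich_def Var_def set_lebesgue_integral_def)
  next
    case False
    have "compact_conjugate Y \<psi>0" "compact_conjugate Y \<psi>1"
      using Y False \<psi> by (auto simp: compact_conjugate_def C_b_def)
    then show ?thesis unfolding K_def \<rho>_def
      using b(1) by (intro variance_bound[OF R _ L]) auto
  qed
  ultimately show "\<exists>K>0. \<forall>\<psi>0\<in>C_b Y. \<forall>\<psi>1\<in>C_b Y.
       Var \<rho> (\<lambda>x. conjugate Y \<psi>1 x - conjugate Y \<psi>0 x)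
         \<le> K * (kantorovich \<rho> X Y \<psi>1 - kantorovich \<rho> X Y \<psi>0
                + (LINT y:Y|distr \<rho> borel (gradient (conjugate Y \<psi>0)). \<psi>1 y - \<psi>0 y))"
    by blast
qed

end
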